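(* Let $n\ge1$, let $X$ be a random vector in $\mathbb{R}^n$ with a log-concave density $\exp(-f)$ and let $\eta\in\mathbb{R}^n$ be a non-zero vector. Denote by $\alpha_\eta:\mathbb{R}\to[0,\infty)$ the (log-concave) density function of $\langle\eta,X\rangle$. Define, for each $t>0$ and each $x\in\mathbb{R}^n$ satisfying $f(x)<\infty$, $$D_{\eta,x}(t):=\inf_{\substack{x^+,x^-\in\mathbb{R}^n\\ x^++x^-=2x\\ \langle\eta,x^+-x^-\rangle=2t}}\frac{f(x^+)+f(x^-)-2f(x)}{2}.$$ Define further, for each $D\ge0$, $t>0$ and $s\in\mathbb{R}$ satisfying $\alpha_\eta(s)>0$, $$\gamma_\eta(D,s,t):=\mathbb{P}\big(D_{\eta,X}(t)\ge D\,\big|\,\langle\eta,X\rangle=s\big).$$ Then the inequality $$\sqrt{\alpha_\eta(s-t)\,\alpha_\eta(s+t)}\le\big(1-\gamma_\eta(D,s,t)(1-e^{-D})\big)\cdot\alpha_\eta(s)$$ holds for every $D\ge0$, $t>0$ and $s\in\mathbb{R}$ with $\alpha_\eta(s)>0$. In particular, if $\mathbb{P}(D_{\eta,X}(t)\ge D)\ge\frac34$ then $$\mathbb{P}\left(\sqrt{\alpha_\eta(\langle\eta,X\rangle+t)\,\alpha_\eta(\langle\eta,X\rangle-t)}\le\Big(1-\tfrac12\big(1-e^{-D}\big)\Big)\alpha_\eta(\langle\eta,X\rangle)\right)\ge\frac12.$$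
   Context: A log-concave density on $\mathbb{R}^n$ is a probability density (with respect to Lebesgue measure) of the form $\exp(-f)$ with $f:\mathbb{R}^n\to(-\infty,\infty]$ convex; by convention $\{x:f(x)<\infty\}$ is open. Let $m_{n-1}$ denote $(n-1)$-dimensional Hausdorff measure. The version of the density used is $\alpha_\eta(r)=\frac1{\|\eta\|}\int_{\{x:\langle\eta,x\rangle=r\}}e^{-f(x)}\,dm_{n-1}(x)$ for $r\in\mathbb{R}$. The conditional probability $\gamma_\eta(D,s,t)$ is defined for every $s$ with $\alpha_\eta(s)>0$ by the version $$\gamma_\eta(D,s,t)=\frac{\int_{\{x:\langle\eta,x\rangle=s,\ f(x)<\infty,\ D_{\eta,x}(t)\ge D\}}e^{-f(x)}\,dm_{n-1}(x)}{\int_{\{x:\langle\eta,x\rangle=s\}}e^{-f(x)}\,dm_{n-1}(x)}.$$ The quantity $D_{\eta,x}(t)$ takes values in $[0,\infty]$, by convexity of $f$. *)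

theory Defs
  imports "HOL-Probability.Probability"
begin

section \<open>Hausdorff measure of integer dimension\<close>

text \<open>
  The normalising constant is the volume of the \<open>d\<close>-dimensional unit ball divided by \<open>2 ^ d\<close>, so
  that the \<open>d\<close>-dimensional Hausdorff measure agrees with \<open>d\<close>-dimensional Lebesgue measure on
  \<open>d\<close>-dimensional affine subspaces.  The empty set has weight 0 for every \<open>d\<close>, and a nonempty set
  has weight 1 for \<open>d = 0\<close>, which makes the 0-dimensional measure the counting measure.
\<close>

definition hausdorff_weight :: "nat \<Rightarrow> 'a::metric_space set \<Rightarrow> ennreal" where
  "hausdorff_weight d U =
     (if U = {} then 0 else ennreal (unit_ball_vol (real d) * (diameter U / 2) ^ d))"

text \<open>Boundedness is required explicitly because \<open>diameter\<close> is unspecified on unbounded sets.\<close>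

definition hausdorff_covers :: "real \<Rightarrow> 'a::metric_space set \<Rightarrow> (nat \<Rightarrow> 'a set) set" where
  "hausdorff_covers \<delta> A =
     {U. A \<subseteq> (\<Union>i. U i) \<and> (\<forall>i. bounded (U i) \<and> diameter (U i) \<le> \<delta>)}"

definition hausdorff_content :: "nat \<Rightarrow> real \<Rightarrow> 'a::metric_space set \<Rightarrow> ennreal" where
  "hausdorff_content d \<delta> A = (INF U\<in>hausdorff_covers \<delta> A. \<Sum>i. hausdorff_weight d (U i))"

definition hausdorff_outer :: "nat \<Rightarrow> 'a::metric_space set \<Rightarrow> ennreal" where
  "hausdorff_outer d A = (SUP \<delta>\<in>{0<..}. hausdorff_content d \<delta> A)"

text \<open>
  \<open>measure_of\<close> yields the null measure if the given set function is not a measure; lemma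
  \<open>emeasure_hausdorff\<close> below shows that this does not happen here.
\<close>

definition hausdorff_measure :: "nat \<Rightarrow> 'a::metric_space measure" where
  "hausdorff_measure d = measure_of UNIV (sets borel) (hausdorff_outer d)"

lemma space_hausdorff [simp]: "space (hausdorff_measure d) = UNIV"
  by (simp add: hausdorff_measure_def space_measure_of_conv)

lemma sets_hausdorff [simp, measurable_cong]: "sets (hausdorff_measure d) = sets borel"
  unfolding hausdorff_measure_def
  by (metis sets.sigma_sets_eq sets_measure_of sets.space_closed space_borel)

lemma hausdorff_weight_empty [simp]: "hausdorff_weight d {} = 0"
  by (simp add: hausdorff_weight_def)

lemma hausdorff_weight_mono:
  assumes "U \<subseteq> V" "bounded V"
  shows "hausdorff_weight d U \<le> hausdorff_weight d V"
proof (cases "U = {}")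
  case False
  have "bounded U" using assms bounded_subset by blast
  then have "0 \<le> diameter U" "diameter U \<le> diameter V"
    using assms by (auto simp: diameter_ge_0 diameter_subset)
  then show ?thesis
    using False assms unfolding hausdorff_weight_def
    by (auto intro!: ennreal_leI mult_left_mono power_mono unit_ball_vol_pos[THEN less_imp_le])
qed simp

lemma hausdorff_content_antimono:
  assumes "\<delta> \<le> \<delta>'"
  shows "hausdorff_content d \<delta>' A \<le> hausdorff_content d \<delta> A"
  unfolding hausdorff_content_def
  using assms by (intro INF_superset_mono) (auto simp: hausdorff_covers_def intro: order_trans)

lemma hausdorff_content_le_outer: "0 < \<delta> \<Longrightarrow> hausdorff_content d \<delta> A \<le> hausdorff_outer d A"
  unfolding hausdorff_outer_def by (rule SUP_upper) simp

lemma hausdorff_content_mono: "A \<subseteq> B \<Longrightarrow> hausdorff_content d \<delta> A \<le> hausdorff_content d \<delta> B"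
  unfolding hausdorff_content_def
  by (intro INF_superset_mono) (auto simp: hausdorff_covers_def)

lemma hausdorff_outer_mono: "A \<subseteq> B \<Longrightarrow> hausdorff_outer d A \<le> hausdorff_outer d B"
  unfolding hausdorff_outer_def by (intro SUP_mono) (auto intro: hausdorff_content_mono)

lemma hausdorff_outer_empty [simp]: "hausdorff_outer d {} = 0"
proof -
  have "hausdorff_content d \<delta> ({}::'a set) = 0" if "0 < \<delta>" for \<delta>
  proof -
    have "(\<lambda>_. {}) \<in> hausdorff_covers \<delta> ({}::'a set)"
      using that by (auto simp: hausdorff_covers_def)
    from INF_lower[OF this, of "\<lambda>U. \<Sum>i. hausdorff_weight d (U i)"] show ?thesis
      by (simp add: hausdorff_content_def)
  qed
  then show ?thesis
    unfolding hausdorff_outer_def by (auto intro!: SUP_eq_const)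
qed

lemma hausdorff_content_subadditive:
  fixes A :: "nat \<Rightarrow> 'a::metric_space set"
  shows "hausdorff_content d \<delta> (\<Union>i. A i) \<le> (\<Sum>n. hausdorff_content d \<delta> (A n))"
proof (rule ennreal_le_epsilon)
  let ?O = "hausdorff_content d \<delta>"
  fix e :: real assume "0 < e" "(\<Sum>n. ?O (A n)) < top"
  then have *: "?O (A n) < ?O (A n) + e * (1/2) ^ Suc n" for n
    by (auto simp add: less_top dest!: ennreal_suminf_lessD)
  have "\<exists>B. B \<in> hausdorff_covers \<delta> (A n) \<and>
    (\<Sum>i. hausdorff_weight d (B i)) \<le> ?O (A n) + e * (1/2) ^ Suc n" for n
  proof -
    have "(INF U\<in>hausdorff_covers \<delta> (A n). \<Sum>i. hausdorff_weight d (U i))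
        < ?O (A n) + e * (1/2) ^ Suc n"
      using *[of n] by (simp add: hausdorff_content_def)
    then show ?thesis unfolding INF_less_iff by (auto intro: less_imp_le)
  qed
  then obtain B where B: "\<And>n. B n \<in> hausdorff_covers \<delta> (A n)"
    and Ble: "\<And>n. (\<Sum>i. hausdorff_weight d (B n i)) \<le> ?O (A n) + e * (1/2) ^ Suc n"
    by metis
  define C where "C = case_prod B o prod_decode"
  have "(\<Union>i. A i) \<subseteq> (\<Union>i. C i)"
  proof
    fix x assume "x \<in> (\<Union>i. A i)"
    then obtain n where "x \<in> A n" by auto
    then obtain i where "x \<in> B n i" using B[of n] by (auto simp: hausdorff_covers_def)
    then have "x \<in> C (prod_encode (n, i))" by (simp add: C_def)
    then show "x \<in> (\<Union>i. C i)" by blast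
  qed
  then have "C \<in> hausdorff_covers \<delta> (\<Union>i. A i)"
    using B by (auto simp: hausdorff_covers_def C_def split_def)
  then have "?O (\<Union>i. A i) \<le> (\<Sum>i. hausdorff_weight d (C i))"
    unfolding hausdorff_content_def by (rule INF_lower)
  also have "\<dots> = (\<Sum>n. \<Sum>i. hausdorff_weight d (B n i))"
    using suminf_ennreal_2dimen[of "\<lambda>n. \<Sum>i. hausdorff_weight d (B n i)"
        "\<lambda>(n, i). hausdorff_weight d (B n i)"]
    by (simp add: C_def comp_def split_def)
  also have "\<dots> \<le> (\<Sum>n. ?O (A n) + e * (1/2) ^ Suc n)"
    by (intro suminf_le Ble) auto
  also have "\<dots> = (\<Sum>n. ?O (A n)) + (\<Sum>n. ennreal e * ennreal ((1/2) ^ Suc n))"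
    using \<open>0 < e\<close> by (subst suminf_add[symmetric])
                     (auto simp del: ennreal_suminf_cmult simp add: ennreal_mult[symmetric])
  also have "\<dots> = (\<Sum>n. ?O (A n)) + e"
    unfolding ennreal_suminf_cmult
    by (subst suminf_ennreal_eq[OF zero_le_power power_half_series]) auto
  finally show "?O (\<Union>i. A i) \<le> (\<Sum>n. ?O (A n)) + e" .
qed

lemma hausdorff_outer_subadditive:
  "hausdorff_outer d (\<Union>i. A i) \<le> (\<Sum>n. hausdorff_outer d (A n))"
  unfolding hausdorff_outer_def[of d "\<Union>i. A i"]
proof (rule SUP_least)
  fix \<delta> :: real assume "\<delta> \<in> {0<..}"
  then have "(\<Sum>n. hausdorff_content d \<delta> (A n)) \<le> (\<Sum>n. hausdorff_outer d (A n))"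
    by (intro suminf_le hausdorff_content_le_outer) auto
  with hausdorff_content_subadditive show
    "hausdorff_content d \<delta> (\<Union>i. A i) \<le> (\<Sum>n. hausdorff_outer d (A n))"
    by (rule order_trans)
qed

lemma outer_measure_space_hausdorff:
  "outer_measure_space UNIV (hausdorff_outer d)"
  unfolding outer_measure_space_def positive_def increasing_def countably_subadditive_def
  by (auto intro: hausdorff_outer_mono hausdorff_outer_subadditive)

lemma hausdorff_outer_Un: "hausdorff_outer d (A \<union> B) \<le> hausdorff_outer d A + hausdorff_outer d B"
proof -
  have eq: "(\<Union>i. if i = 0 then A else if i = Suc 0 then B else {}) = A \<union> B"
    by (auto split: if_splits)
  have "hausdorff_outer d (A \<union> B)
      \<le> (\<Sum>i. hausdorff_outer d (if i = 0 then A else if i = Suc 0 then B else {}))"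
    using hausdorff_outer_subadditive[of d "\<lambda>i. if i = 0 then A else if i = Suc 0 then B else {}"]
    unfolding eq .
  also have "\<dots> = hausdorff_outer d A + hausdorff_outer d B"
    by (subst suminf_finite[of "{0, Suc 0}"]) auto
  finally show ?thesis .
qed

lemma hausdorff_outer_separated:
  assumes e: "0 < e" and sep: "\<And>x y. x \<in> A \<Longrightarrow> y \<in> B \<Longrightarrow> e \<le> dist x y"
  shows "hausdorff_outer d A + hausdorff_outer d B \<le> hausdorff_outer d (A \<union> B)"
proof -
  have small: "hausdorff_content d \<delta> A + hausdorff_content d \<delta> B \<le> hausdorff_content d \<delta> (A \<union> B)"
    if "\<delta> < e" for \<delta>
    unfolding hausdorff_content_def[of d \<delta> "A \<union> B"]
  proof (rule INF_greatest)
    fix U assume U: "U \<in> hausdorff_covers \<delta> (A \<union> B)"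
    have bd: "bounded (U i)" "diameter (U i) \<le> \<delta>" for i
      using U by (auto simp: hausdorff_covers_def)
    have diam: "diameter (U i \<inter> C) \<le> \<delta>" for i C
      using diameter_subset[of "U i \<inter> C" "U i"] bd[of i] by auto
    have "(\<lambda>i. U i \<inter> A) \<in> hausdorff_covers \<delta> A" "(\<lambda>i. U i \<inter> B) \<in> hausdorff_covers \<delta> B"
      using U diam by (auto simp: hausdorff_covers_def intro: bounded_subset)
    then have "hausdorff_content d \<delta> A + hausdorff_content d \<delta> B
        \<le> (\<Sum>i. hausdorff_weight d (U i \<inter> A)) + (\<Sum>i. hausdorff_weight d (U i \<inter> B))"
      unfolding hausdorff_content_def by (intro add_mono INF_lower)
    also have "\<dots> = (\<Sum>i. hausdorff_weight d (U i \<inter> A) + hausdorff_weight d (U i \<inter> B))"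
      by (rule suminf_add) auto
    also have "\<dots> \<le> (\<Sum>i. hausdorff_weight d (U i))"
    proof (rule suminf_le)
      fix i
      have "U i \<inter> A = {} \<or> U i \<inter> B = {}"
      proof (rule ccontr)
        assume "\<not> ?thesis"
        then obtain x y where xy: "x \<in> U i" "x \<in> A" "y \<in> U i" "y \<in> B" by auto
        then have "dist x y \<le> diameter (U i)" using bd diameter_bounded_bound by blast
        with sep[OF xy(2,4)] bd(2)[of i] that show False by simp
      qed
      then show "hausdorff_weight d (U i \<inter> A) + hausdorff_weight d (U i \<inter> B)
          \<le> hausdorff_weight d (U i)"
        using hausdorff_weight_mono[OF _ bd(1), of "U i \<inter> A" i d]
          hausdorff_weight_mono[OF _ bd(1), of "U i \<inter> B" i d] by auto
    qed auto
    finally show "hausdorff_content d \<delta> A + hausdorff_content d \<delta> B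
        \<le> (\<Sum>i. hausdorff_weight d (U i))" .
  qed
  have "hausdorff_outer d A + hausdorff_outer d B
      = (SUP \<delta>\<in>{0<..}. hausdorff_content d \<delta> A + hausdorff_content d \<delta> B)"
    unfolding hausdorff_outer_def
  proof (rule SUP_add_directed_ennreal[symmetric])
    fix i j :: real assume "i \<in> {0<..}" "j \<in> {0<..}"
    then show "\<exists>k\<in>{0<..}. hausdorff_content d i A + hausdorff_content d j B
        \<le> hausdorff_content d k A + hausdorff_content d k B"
      by (intro bexI[of _ "min i j"] add_mono hausdorff_content_antimono) auto
  qed
  also have "\<dots> \<le> hausdorff_outer d (A \<union> B)"
  proof (rule SUP_least)
    fix \<delta> :: real assume \<delta>: "\<delta> \<in> {0<..}"
    let ?\<delta> = "min \<delta> (e/2)"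
    have "hausdorff_content d \<delta> A + hausdorff_content d \<delta> B
        \<le> hausdorff_content d ?\<delta> A + hausdorff_content d ?\<delta> B"
      by (intro add_mono hausdorff_content_antimono) auto
    also have "\<dots> \<le> hausdorff_content d ?\<delta> (A \<union> B)"
      using e by (intro small) auto
    also have "\<dots> \<le> hausdorff_outer d (A \<union> B)"
      using e \<delta> by (intro hausdorff_content_le_outer) auto
    finally show "hausdorff_content d \<delta> A + hausdorff_content d \<delta> B \<le> hausdorff_outer d (A \<union> B)" .
  qed
  finally show ?thesis .
qed

lemma hausdorff_outer_shells:
  fixes F :: "'a::metric_space set" and a b :: "nat \<Rightarrow> real"
  assumes R: "\<And>k x. x \<in> R k \<Longrightarrow> a k \<le> infdist x F \<and> infdist x F \<le> b k"
    and ab: "\<And>k. b (Suc k) < a k" "\<And>k. a k \<le> b k"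
  shows "(\<Sum>k. hausdorff_outer d (R k)) \<le> hausdorff_outer d (\<Union>k. R k)"
proof -
  have less: "b m < a k" if "k < m" for k m
    using that
  proof (induction m)
    case (Suc m)
    then show ?case
      using ab(1)[of m] ab(2)[of m] by (cases "k = m") auto
  qed simp
  have fin: "(\<Sum>k<m. hausdorff_outer d (R k)) \<le> hausdorff_outer d (\<Union>k<m. R k)" for m
  proof (induction m)
    case (Suc m)
    have "hausdorff_outer d (\<Union>k<m. R k) + hausdorff_outer d (R m)
        \<le> hausdorff_outer d ((\<Union>k<m. R k) \<union> R m)"
    proof (cases "m = 0")
      case False
      define e where "e = Min (a ` {..<m}) - b m"
      have "0 < e" using less False by (subst e_def, subst diff_gt_0_iff_gt, subst Min_gr_iff) auto
      then show ?thesis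
      proof (rule hausdorff_outer_separated)
        fix x y assume "x \<in> (\<Union>k<m. R k)" and y: "y \<in> R m"
        then obtain k where k: "k < m" "x \<in> R k" by auto
        have "Min (a ` {..<m}) \<le> a k" using k by (intro Min_le) auto
        also have "a k \<le> infdist x F" using R[OF k(2)] by simp
        also have "\<dots> \<le> infdist y F + dist x y" by (rule infdist_triangle)
        also have "infdist y F \<le> b m" using R[OF y] by simp
        finally show "e \<le> dist x y" by (simp add: e_def)
      qed
    qed simp
    then have "(\<Sum>k<m. hausdorff_outer d (R k)) + hausdorff_outer d (R m)
        \<le> hausdorff_outer d ((\<Union>k<m. R k) \<union> R m)"
      using Suc.IH by (meson add_right_mono order_trans)
    then show ?case by (simp add: lessThan_Suc Un_commute add.commute)
  qed simp
  show ?thesis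
  proof (rule suminf_le_const)
    fix m
    show "(\<Sum>k<m. hausdorff_outer d (R k)) \<le> hausdorff_outer d (\<Union>k. R k)"
      by (rule order_trans[OF fin hausdorff_outer_mono]) auto
  qed auto
qed

lemma hausdorff_outer_closed_split:
  fixes F S :: "'a::metric_space set"
  assumes F: "closed F"
  shows "hausdorff_outer d (S \<inter> F) + hausdorff_outer d (S - F) \<le> hausdorff_outer d S"
proof (cases "F = {} \<or> hausdorff_outer d S = top")
  case True
  then show ?thesis by auto
next
  case False
  then have ne: "F \<noteq> {}" and fin: "hausdorff_outer d S < top"
    by (auto simp: less_top)
  let ?H = "hausdorff_outer d :: 'a set \<Rightarrow> ennreal"
  define T where "T n = {x\<in>S. 1 / real (Suc n) \<le> infdist x F}" for n
  define R where "R n = {x\<in>S. 1 / real (Suc (Suc n)) \<le> infdist x F \<and> infdist x F \<le> 1 / real (Suc n)}" for n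
  have RS: "(\<Union>k. R (h k)) \<subseteq> S" for h :: "nat \<Rightarrow> nat" by (auto simp: R_def)
  have half: "(\<Sum>k. ?H (R (2 * k + i))) \<le> ?H S" for i
  proof -
    have "(\<Sum>k. ?H (R (2 * k + i))) \<le> ?H (\<Union>k. R (2 * k + i))"
      by (rule hausdorff_outer_shells[where F = F
            and a = "\<lambda>k. 1 / real (Suc (Suc (2 * k + i)))" and b = "\<lambda>k. 1 / real (Suc (2 * k + i))"])
         (auto simp: R_def divide_simps)
    also have "\<dots> \<le> ?H S" by (rule hausdorff_outer_mono[OF RS])
    finally show ?thesis .
  qed
  have part: "(\<Sum>k<m. ?H (R k)) \<le> ?H S + ?H S" for m
  proof -
    have "(\<Sum>k<m. ?H (R k)) \<le> (\<Sum>k<2*m. ?H (R k))"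
      by (intro sum_mono2) auto
    also have "\<dots> = (\<Sum>k<m. ?H (R (2*k+0))) + (\<Sum>k<m. ?H (R (2*k+1)))"
      by (induction m) (auto simp: algebra_simps)
    also have "\<dots> \<le> (\<Sum>k. ?H (R (2*k+0))) + (\<Sum>k. ?H (R (2*k+1)))"
      by (intro add_mono sum_le_suminf) auto
    also have "\<dots> \<le> ?H S + ?H S" by (intro add_mono half)
    finally show ?thesis .
  qed
  have sum_fin: "(\<Sum>k. ?H (R k)) \<noteq> top"
  proof -
    have "(\<Sum>k. ?H (R k)) \<le> ?H S + ?H S" by (rule suminf_le_const) (auto intro: part)
    also have "\<dots> < top" using fin by simp
    finally show ?thesis by simp
  qed
  define r where "r k = enn2real (?H (R k))" for k
  have r: "?H (R k) = ennreal (r k)" for k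
    using order_le_less_trans[OF hausdorff_outer_mono fin, of "R k"] by (auto simp: r_def R_def)
  have r0: "0 \<le> r k" for k by (simp add: r_def)
  have "summable r"
    using sum_fin r0 by (auto intro!: summable_suminf_not_top simp: r)
  show ?thesis
  proof (rule ennreal_le_epsilon)
    fix e :: real assume "0 < e"
    obtain n where n: "norm (\<Sum>k. r (k + n)) < e"
      using suminf_exist_split[OF \<open>0 < e\<close> \<open>summable r\<close>] by blast
    have "S - F \<subseteq> T n \<union> (\<Union>k. R (k + n))"
    proof
      fix x assume x: "x \<in> S - F"
      then have pos: "0 < infdist x F" using F ne infdist_pos_not_in_closed by blast
      show "x \<in> T n \<union> (\<Union>k. R (k + n))"
      proof (cases "x \<in> T n")
        case False
        then have lt: "infdist x F < 1 / real (Suc n)" using x by (auto simp: T_def)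
        define m where "m = (LEAST m. 1 / real (Suc m) \<le> infdist x F)"
        obtain m0 where "1 / real (Suc m0) < infdist x F" using nat_approx_posE[OF pos] .
        then have m1: "1 / real (Suc m) \<le> infdist x F"
          using LeastI[of "\<lambda>m. 1 / real (Suc m) \<le> infdist x F" m0] by (simp only: m_def)
        have "n < m"
        proof (rule ccontr)
          assume "\<not> n < m"
          then have "1 / real (Suc n) \<le> 1 / real (Suc m)" by (simp add: frac_le)
          with m1 lt show False by simp
        qed
        then obtain p where p: "m = Suc p" "n \<le> p" by (cases m) auto
        have "\<not> 1 / real (Suc p) \<le> infdist x F"
          using p(1) not_less_Least[of p "\<lambda>m. 1 / real (Suc m) \<le> infdist x F"]
          by (simp add: m_def del: of_nat_Suc)
        then have "x \<in> R ((p - n) + n)" using p m1 x by (auto simp: R_def)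
        then show ?thesis by blast
      qed simp
    qed
    then have "?H (S - F) \<le> ?H (T n \<union> (\<Union>k. R (k + n)))" by (rule hausdorff_outer_mono)
    also have "\<dots> \<le> ?H (T n) + ?H (\<Union>k. R (k + n))" by (rule hausdorff_outer_Un)
    also have "?H (\<Union>k. R (k + n)) \<le> (\<Sum>k. ?H (R (k + n)))" by (rule hausdorff_outer_subadditive)
    also have "\<dots> = ennreal (\<Sum>k. r (k + n))"
      unfolding r using \<open>summable r\<close> r0 by (intro suminf_ennreal2) (auto intro: summable_ignore_initial_segment)
    also have "\<dots> \<le> ennreal e" using n by (intro ennreal_leI) simp
    finally have SF: "?H (S - F) \<le> ?H (T n) + ennreal e" by (simp add: add_left_mono)
    have "?H (S \<inter> F) + ?H (T n) \<le> ?H ((S \<inter> F) \<union> T n)"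
    proof (rule hausdorff_outer_separated[where e = "1 / real (Suc n)"])
      fix x y assume "x \<in> S \<inter> F" "y \<in> T n"
      then show "1 / real (Suc n) \<le> dist x y"
        using infdist_le[of x F y] by (auto simp: T_def dist_commute)
    qed simp
    also have "\<dots> \<le> ?H S" by (rule hausdorff_outer_mono) (auto simp: T_def)
    finally have "?H (S \<inter> F) + ?H (T n) \<le> ?H S" .
    then have "?H (S \<inter> F) + (?H (T n) + ennreal e) \<le> ?H S + ennreal e"
      by (simp add: add.assoc[symmetric] add_right_mono)
    with SF show "?H (S \<inter> F) + ?H (S - F) \<le> ?H S + ennreal e"
      by (meson add_left_mono order_trans)
  qed
qed

lemma emeasure_hausdorff:
  fixes A :: "'a::metric_space set"
  assumes "A \<in> sets borel"
  shows "emeasure (hausdorff_measure d) A = hausdorff_outer d A"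
proof -
  let ?L = "lambda_system UNIV UNIV (hausdorff_outer d :: 'a set \<Rightarrow> ennreal)"
  interpret P: sigma_algebra "UNIV :: 'a set" UNIV
    using sigma_algebra_Pow[of "UNIV :: 'a set"] by simp
  have ms: "measure_space UNIV ?L (hausdorff_outer d)"
    by (rule P.caratheodory_lemma[OF outer_measure_space_hausdorff])
  then interpret L: sigma_algebra "UNIV :: 'a set" ?L by (simp add: measure_space_def)
  have "closed F \<Longrightarrow> F \<in> ?L" for F :: "'a set"
    unfolding P.lambda_system_eq
  proof safe
    fix S assume "closed F"
    have "hausdorff_outer d S \<le> hausdorff_outer d (S \<inter> F) + hausdorff_outer d (S - F)"
      using hausdorff_outer_Un[of d "S \<inter> F" "S - F"] by (simp add: Int_Diff_Un)
    with hausdorff_outer_closed_split[OF \<open>closed F\<close>]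
    show "hausdorff_outer d (S \<inter> F) + hausdorff_outer d (S - F) = hausdorff_outer d S"
      by (rule antisym)
  qed simp
  then have "sets (borel :: 'a measure) \<subseteq> ?L"
    unfolding borel_eq_closed by (subst sets_measure_of) (auto intro!: L.sigma_sets_subset)
  then have "countably_additive (sets borel) (hausdorff_outer d :: 'a set \<Rightarrow> ennreal)"
    using ms unfolding measure_space_def countably_additive_def by blast
  then show ?thesis
    using assms unfolding hausdorff_measure_def
    using sets.sigma_algebra_axioms[of "borel :: 'a measure"]
    by (intro emeasure_measure_of_sigma) (auto simp: positive_def)
qed


section \<open>Log-concave densities\<close>

text \<open>The value at \<open>-\<infinity>\<close> is irrelevant: the functions below never take it.\<close>

definition exp_minus :: "ereal \<Rightarrow> real" where
  "exp_minus a = (if a = \<infinity> then 0 else exp (- real_of_ereal a))"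

text \<open>\<open>convex_on\<close> is restricted to real-valued functions.\<close>

definition convex_extended :: "('a::real_vector \<Rightarrow> ereal) \<Rightarrow> bool" where
  "convex_extended f \<longleftrightarrow> (\<forall>x. f x \<noteq> -\<infinity>) \<and>
     (\<forall>x y u. 0 < u \<longrightarrow> u < 1 \<longrightarrow>
        f (u *\<^sub>R x + (1 - u) *\<^sub>R y) \<le> ereal u * f x + ereal (1 - u) * f y)"

text \<open>\<open>exp (- f)\<close> is a log-concave probability density.\<close>

definition log_concave_potential :: "('a::euclidean_space \<Rightarrow> ereal) \<Rightarrow> bool" where
  "log_concave_potential f \<longleftrightarrow>
     convex_extended f \<and> open {x. f x < \<infinity>} \<and> (\<integral>\<^sup>+x. ennreal (exp_minus (f x)) \<partial>lborel) = 1"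


section \<open>Marginal density, midpoint defect and conditional probability\<close>

definition marginal_density :: "(real^'n \<Rightarrow> ereal) \<Rightarrow> real^'n \<Rightarrow> real \<Rightarrow> real" where
  "marginal_density f \<eta> r =
     1 / norm \<eta> * (LINT x:{x. \<eta> \<bullet> x = r}|hausdorff_measure (CARD('n) - 1). exp_minus (f x))"

text \<open>Only meaningful for \<open>f x < \<infinity>\<close>.\<close>

definition midpoint_defect :: "(real^'n \<Rightarrow> ereal) \<Rightarrow> real^'n \<Rightarrow> real^'n \<Rightarrow> real \<Rightarrow> ereal" where
  "midpoint_defect f \<eta> x t =
     (INF (xp, xm) \<in> {(xp, xm). xp + xm = 2 *\<^sub>R x \<and> \<eta> \<bullet> (xp - xm) = 2 * t}.
        (f xp + f xm - 2 * f x) / 2)"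

text \<open>
  The version of the conditional probability of \<open>midpoint_defect f \<eta> X t \<ge> D\<close> given \<open>\<eta> \<bullet> X = s\<close>
  for \<open>X\<close> with density \<open>exp (- f)\<close>; meaningful if \<open>marginal_density f \<eta> s > 0\<close>.
\<close>

definition defect_cond_prob ::
    "(real^'n \<Rightarrow> ereal) \<Rightarrow> real^'n \<Rightarrow> real \<Rightarrow> real \<Rightarrow> real \<Rightarrow> real" where
  "defect_cond_prob f \<eta> D s t =
     (LINT x:{x. \<eta> \<bullet> x = s \<and> f x < \<infinity> \<and> midpoint_defect f \<eta> x t \<ge> ereal D}
        |hausdorff_measure (CARD('n) - 1). exp_minus (f x)) /
     (LINT x:{x. \<eta> \<bullet> x = s}|hausdorff_measure (CARD('n) - 1). exp_minus (f x))"

end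

(*
  If x is the midpoint of y and z and lies in the defect set, then
  exp (-f y) exp (-f z) <= (exp (-f x) exp (-D))^2; without the defect the factor exp (-D) is absent.
  Hence the Prekopa-Leindler inequality on a hyperplane, applied to the slices of exp (-f) at s - t and
  s + t and to the slice at s damped by exp (-D) on the defect set, gives the first inequality.
  Where the conclusion of the second part fails, the conditional probability of the defect set is below
  1/2, so the probability of failure is at most twice the probability of missing the defect set.

  Hausdorff measure on a hyperplane is proportional to a projection of Lebesgue measure, by uniqueness
  of translation-invariant measures. Only finiteness of the constant matters: the inequalities are
  homogeneous in it, and trivial if it vanishes.
*)
theory Submission
  imports Defs
begin

section \<open>The Prekopa-Leindler inequality\<close>

text \<open>The first inequality is claimed for every \<open>s\<close> and for one fixed version of
  the density, so a disintegration valid at almost every level is not enough: the slice at each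
  level must be compared with Lebesgue measure, with one constant for all levels. Prekopa-Leindler
  is proved for functions with values in \<open>ennreal\<close> and with \<open>h\<close> squared on
  the right: no roots of extended reals occur, infinite integrals are allowed, and the form survives
  integrating out one coordinate at a time. On the line it comes from Brunn-Minkowski for superlevel
  sets. The marginal densities are Bochner integrals, hence 0 on a slice with infinite integral.
  Positivity excludes this at \<open>s\<close>; at \<open>s - t\<close> and \<open>s + t\<close> the
  value 0 only lowers the left-hand side.\<close>

lemma emeasure_lborel_translate:
  fixes A :: "'a::euclidean_space set"
  assumes [measurable]: "A \<in> sets borel"
  shows "emeasure lborel {x. x - c \<in> A} = emeasure lborel A"
proof -
  have "emeasure lborel A = emeasure (distr lborel borel ((+) (- c))) A"
    by (simp add: lborel_distr_plus)
  also have "\<dots> = emeasure lborel {x. x - c \<in> A}"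
    by (subst emeasure_distr) (auto intro!: arg_cong[where f="emeasure lborel"])
  finally show ?thesis ..
qed

text \<open>Up to an overlap of length at most \<open>2 * e\<close>, the translate of \<open>A\<close> by an almost minimal element
  of \<open>B\<close> lies to the left of the translate of \<open>B\<close> by an almost maximal element of \<open>A\<close>.\<close>

lemma brunn_minkowski_real_bounded:
  fixes A B C :: "real set"
  assumes [measurable]: "A \<in> sets borel" "B \<in> sets borel" "C \<in> sets borel"
    and ne: "A \<noteq> {}" "B \<noteq> {}" and bd: "bounded A" "bounded B"
    and sum: "\<And>a b. a \<in> A \<Longrightarrow> b \<in> B \<Longrightarrow> a + b \<in> C"
  shows "emeasure lborel A + emeasure lborel B \<le> emeasure lborel C"
proof (rule ennreal_le_epsilon)
  fix e :: real assume e: "0 < e"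
  have ba: "bdd_above A" and bb: "bdd_below B"
    using bd by (auto intro: bounded_imp_bdd_above bounded_imp_bdd_below)
  obtain a where a: "a \<in> A" "Sup A - e/2 < a"
    using less_cSup_iff[OF ne(1) ba, of "Sup A - e/2"] e by auto
  obtain b where b: "b \<in> B" "b < Inf B + e/2"
    using cInf_less_iff[OF ne(2) bb, of "Inf B + e/2"] e by auto
  define A' where "A' = {x. x - b \<in> A}"
  define B' where "B' = {x. x - a \<in> B}"
  have [measurable]: "A' \<in> sets borel" "B' \<in> sets borel"
    unfolding A'_def B'_def by measurable
  have "emeasure lborel A + emeasure lborel B = emeasure lborel A' + emeasure lborel B'"
    unfolding A'_def B'_def by (simp add: emeasure_lborel_translate)
  also have "\<dots> = emeasure lborel (A' \<union> B') + emeasure lborel (A' \<inter> B')"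
    by (rule emeasure_Un_Int) auto
  also have "\<dots> \<le> emeasure lborel C + emeasure lborel {a + Inf B .. Sup A + b}"
  proof (intro add_mono emeasure_mono)
    show "A' \<union> B' \<subseteq> C"
      using sum[OF _ b(1)] sum[OF a(1)] by (force simp: A'_def B'_def)
    show "A' \<inter> B' \<subseteq> {a + Inf B..Sup A + b}"
      using cSup_upper[OF _ ba] cInf_lower[OF _ bb] by (force simp: A'_def B'_def)
  qed auto
  also have "emeasure lborel {a + Inf B .. Sup A + b} \<le> ennreal e"
    using a b e by (auto simp: emeasure_lborel_Icc_eq intro!: ennreal_leI)
  finally show "emeasure lborel A + emeasure lborel B \<le> emeasure lborel C + ennreal e"
    by (simp add: add_left_mono)
qed

lemma emeasure_lborel_SUP_bounded:
  fixes A :: "real set"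
  assumes [measurable]: "A \<in> sets borel"
  shows "emeasure lborel A = (SUP n. emeasure lborel (A \<inter> {- real n..real n}))"
proof -
  have "(SUP n. emeasure lborel (A \<inter> {- real n..real n})) = emeasure lborel (\<Union>n. A \<inter> {- real n..real n})"
    by (intro SUP_emeasure_incseq) (auto simp: incseq_def)
  also have "(\<Union>n. A \<inter> {- real n..real n}) = A"
  proof safe
    fix x assume "x \<in> A"
    moreover obtain n where "\<bar>x\<bar> \<le> real n" using real_arch_simple by blast
    ultimately show "x \<in> (\<Union>n. A \<inter> {- real n..real n})" by (intro UN_I[of n]) (auto simp: abs_le_iff)
  qed
  finally show ?thesis ..
qed

lemma brunn_minkowski_real:
  fixes A B C :: "real set"
  assumes [measurable]: "A \<in> sets borel" "B \<in> sets borel" "C \<in> sets borel"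
    and ne: "A \<noteq> {}" "B \<noteq> {}"
    and sum: "\<And>a b. a \<in> A \<Longrightarrow> b \<in> B \<Longrightarrow> a + b \<in> C"
  shows "emeasure lborel A + emeasure lborel B \<le> emeasure lborel C"
proof -
  obtain a b where ab: "a \<in> A" "b \<in> B" using ne by auto
  obtain N where N: "\<bar>a\<bar> \<le> real N" "\<bar>b\<bar> \<le> real N"
    using real_arch_simple[of "max \<bar>a\<bar> \<bar>b\<bar>"] by auto
  \<comment> \<open>The windows have half-width at least \<open>N\<close>, so each contains
    \<open>a\<close> and \<open>b\<close>: the bounded case needs both truncations nonempty.\<close>
  define I where "I n = {- real (n + N)..real (n + N)}" for n
  have eq: "emeasure lborel S = (SUP n. emeasure lborel (S \<inter> I n))" if "S \<in> sets borel" for S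
    unfolding I_def emeasure_lborel_SUP_bounded[OF that]
  proof (rule antisym; rule SUP_mono)
    show "\<exists>m\<in>UNIV. emeasure lborel (S \<inter> {- real n..real n}) \<le> emeasure lborel (S \<inter> {- real (m + N)..real (m + N)})" for n
      using that by (intro bexI[of _ n] emeasure_mono) auto
    show "\<exists>m\<in>UNIV. emeasure lborel (S \<inter> {- real (n + N)..real (n + N)}) \<le> emeasure lborel (S \<inter> {- real m..real m})" for n
      using that by (intro bexI[of _ "n + N"] emeasure_mono) auto
  qed
  have inc: "incseq (\<lambda>n. emeasure lborel (S \<inter> I n))" if "S \<in> sets borel" for S
    unfolding I_def using that by (intro incseq_SucI emeasure_mono) auto
  have abI: "a \<in> I n" "b \<in> I n" for n using N by (auto simp: I_def abs_le_iff)
  have "emeasure lborel A + emeasure lborel B = (SUP n. emeasure lborel (A \<inter> I n) + emeasure lborel (B \<inter> I n))"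
    by (subst (1 2) eq) (auto intro!: ennreal_SUP_add[symmetric] inc)
  also have "\<dots> \<le> emeasure lborel C"
  proof (rule SUP_least)
    fix n
    show "emeasure lborel (A \<inter> I n) + emeasure lborel (B \<inter> I n) \<le> emeasure lborel C"
    proof (rule brunn_minkowski_real_bounded)
      show "A \<inter> I n \<noteq> {}" "B \<inter> I n \<noteq> {}" using ab abI by auto
      show "bounded (A \<inter> I n)" "bounded (B \<inter> I n)"
        by (auto simp: I_def intro: bounded_subset[OF bounded_closed_interval])
    qed (auto simp: I_def sum)
  qed
  finally show ?thesis .
qed

section \<open>From Brunn-Minkowski to Prekopa-Leindler on the line\<close>

lemma emeasure_lborel_double:
  fixes C :: "real set"
  assumes [measurable]: "C \<in> sets borel"
  shows "emeasure lborel {z. z / 2 \<in> C} = 2 * emeasure lborel C"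
proof -
  have "emeasure lborel {z. z / 2 \<in> C} = (\<integral>\<^sup>+z. indicator C (z / 2) \<partial>lborel)"
  proof -
    have "indicator {z. z / 2 \<in> C} z = (indicator C (z / 2) :: ennreal)" for z
      by (simp add: indicator_def)
    moreover have "{z. z / 2 \<in> C} \<in> sets lborel" by measurable
    ultimately show ?thesis by (simp flip: nn_integral_indicator)
  qed
  also have "\<dots> = 2 * (\<integral>\<^sup>+z. indicator C z \<partial>lborel)"
    by (subst nn_integral_real_affine[of _ 2 0]) auto
  finally show ?thesis by simp
qed

text \<open>Fubini for the region under the graph. The bound 1 confines the levels to (0,1), and a
  function with supremum 1 has nonempty superlevel sets at all of these.\<close>

lemma nn_integral_layer_cake_le_1:
  fixes f :: "real \<Rightarrow> ennreal"
  assumes [measurable]: "f \<in> borel_measurable borel" and f1: "\<And>x. f x \<le> 1"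
  shows "(\<integral>\<^sup>+x. f x \<partial>lborel) = (\<integral>\<^sup>+l. emeasure lborel {x. ennreal l < f x} * indicator {0<..<1} l \<partial>lborel)"
proof -
  have slice: "(\<integral>\<^sup>+l. indicator {0<..<1} l * indicator {x. ennreal l < f x} x \<partial>lborel) = f x" for x
  proof -
    obtain r where r: "f x = ennreal r" "0 \<le> r" "r \<le> 1"
      using f1[of x] by (cases "f x") (auto simp: top_unique)
    have "(\<integral>\<^sup>+l. indicator {0<..<1} l * indicator {x. ennreal l < f x} x \<partial>lborel)
        = (\<integral>\<^sup>+l. indicator {0<..<r} l \<partial>lborel)"
      using r by (intro nn_integral_cong) (auto simp: ennreal_less_iff split: split_indicator)
    then show ?thesis using r by simp
  qed
  have "(\<integral>\<^sup>+x. f x \<partial>lborel)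
      = (\<integral>\<^sup>+x. (\<integral>\<^sup>+l. indicator {0<..<1} l * indicator {x. ennreal l < f x} x \<partial>lborel) \<partial>lborel)"
    by (simp add: slice)
  also have "\<dots> = (\<integral>\<^sup>+l. (\<integral>\<^sup>+x. indicator {0<..<1} l * indicator {x. ennreal l < f x} x \<partial>lborel) \<partial>lborel)"
  proof (rule lborel_pair.Fubini')
    have "(\<lambda>(l, x). indicator {0<..<1} l * indicator {p. ennreal (fst p) < f (snd p)} (l, x) :: ennreal)
        \<in> borel_measurable (lborel \<Otimes>\<^sub>M lborel)"
      by measurable
    then show "(\<lambda>(l, x). indicator {0<..<1} l * indicator {x. ennreal l < f x} x :: ennreal)
        \<in> borel_measurable (lborel \<Otimes>\<^sub>M lborel)"
      by (simp add: indicator_def)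
  qed
  also have "\<dots> = (\<integral>\<^sup>+l. emeasure lborel {x. ennreal l < f x} * indicator {0<..<1} l \<partial>lborel)"
    by (intro nn_integral_cong) (simp add: nn_integral_cmult mult.commute)
  finally show ?thesis .
qed

text \<open>The inequality of arithmetic and geometric means, from 4xy = (x + y)^2 - (x - y)^2. It
  converts the additive bound that Brunn-Minkowski yields into a multiplicative one.\<close>

lemma ennreal_mult_le_power2:
  fixes a b c :: ennreal
  assumes "a + b \<le> 2 * c"
  shows "a * b \<le> c\<^sup>2"
proof (cases "c = top")
  case True
  then show ?thesis by (simp add: power2_eq_square ennreal_mult_top)
next
  case False
  then obtain r where r: "c = ennreal r" "0 \<le> r" by (cases c) auto
  then have c2: "2 * c = ennreal (2 * r)" by (simp add: ennreal_mult)
  have "a < top" "b < top"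
    using assms unfolding c2 by (auto simp: less_top[symmetric] top_unique)
  then obtain x y where x: "a = ennreal x" "0 \<le> x" and y: "b = ennreal y" "0 \<le> y"
    by (cases a; cases b) auto
  have le: "x + y \<le> 2 * r"
    using assms r unfolding c2 x(1) y(1) by (simp add: x y flip: ennreal_plus)
  have "4 * (x * y) = (x + y)\<^sup>2 - (x - y)\<^sup>2" by (simp add: power2_eq_square algebra_simps)
  also have "\<dots> \<le> (x + y)\<^sup>2" by simp
  also have "\<dots> \<le> (2 * r)\<^sup>2" using le x y by (intro power_mono) auto
  finally have "x * y \<le> r\<^sup>2" by (simp add: power2_eq_square)
  then show ?thesis
    using r x y by (simp add: power2_eq_square flip: ennreal_mult)
qed

text \<open>If \<open>f x\<close> and \<open>g y\<close> exceed a level \<open>l\<close> in (0,1),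
  so does \<open>h\<close> at the midpoint, because its square exceeds \<open>l * l\<close>. Equal
  suprema make the superlevel sets of \<open>f\<close> and \<open>g\<close> nonempty at the same
  levels, so Brunn-Minkowski applies at each of them and can be integrated over
  \<open>l\<close>.\<close>

lemma prekopa_leindler_normalized:
  fixes f g h :: "real \<Rightarrow> ennreal"
  assumes [measurable]: "f \<in> borel_measurable borel" "g \<in> borel_measurable borel" "h \<in> borel_measurable borel"
    and sup: "(SUP x. f x) = 1" "(SUP x. g x) = 1"
    and mid: "\<And>x y. f x * g y \<le> (h ((x + y) / 2))\<^sup>2"
  shows "(\<integral>\<^sup>+x. f x \<partial>lborel) * (\<integral>\<^sup>+x. g x \<partial>lborel) \<le> (\<integral>\<^sup>+x. h x \<partial>lborel)\<^sup>2"
proof -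
  have le1: "f x \<le> 1" "g x \<le> 1" for x using SUP_upper[of x UNIV f] SUP_upper[of x UNIV g] sup by auto
  \<comment> \<open>The truncation changes no superlevel set at a level below 1 and makes the layer
    cake formula applicable to \<open>h\<close>.\<close>
  let ?h = "\<lambda>x. min (h x) 1"
  let ?L = "\<lambda>f l. emeasure lborel {x. ennreal l < f x} * indicator {0<..<1::real} l"
  have level: "?L f l + ?L g l \<le> 2 * ?L ?h l" for l
  proof (cases "l \<in> {0<..<1}")
    case True
    then have l1: "ennreal l < 1" by (simp add: ennreal_less_one_iff)
    have "emeasure lborel {x. ennreal l < f x} + emeasure lborel {x. ennreal l < g x}
        \<le> emeasure lborel {z. z / 2 \<in> {x. ennreal l < ?h x}}"
    proof (rule brunn_minkowski_real)
      show "{x. ennreal l < f x} \<noteq> {}" "{x. ennreal l < g x} \<noteq> {}"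
        using l1 less_SUP_iff[of "ennreal l" f UNIV] less_SUP_iff[of "ennreal l" g UNIV] by (auto simp: sup)
      fix x y assume xy: "x \<in> {x. ennreal l < f x}" "y \<in> {x. ennreal l < g x}"
      show "x + y \<in> {z. z / 2 \<in> {x. ennreal l < ?h x}}"
      proof (rule ccontr)
        assume "\<not> ?thesis"
        then have "h ((x + y) / 2) \<le> ennreal l" using l1 by (auto simp: not_less)
        then have "(h ((x + y) / 2))\<^sup>2 \<le> (ennreal l)\<^sup>2" by (rule power_mono) simp
        with mid[of x y] have "f x * g y \<le> ennreal l * ennreal l"
          by (simp add: power2_eq_square)
        moreover obtain u v where "f x = ennreal u" "0 \<le> u" "g y = ennreal v" "0 \<le> v"
          using le1[of x] le1[of y] by (cases "f x"; cases "g y") (auto simp: top_unique)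
        ultimately have "u * v \<le> l * l" "l < u" "l < v"
          using xy True by (auto simp: ennreal_less_iff simp flip: ennreal_mult)
        moreover have "l * l < u * v" using calculation True by (intro mult_strict_mono) auto
        ultimately show False by simp
      qed
    qed (measurable)
    also have "\<dots> = 2 * emeasure lborel {x. ennreal l < ?h x}"
      by (rule emeasure_lborel_double) measurable
    finally show ?thesis using True by simp
  qed simp
  have [measurable]: "(\<lambda>l. ?L u l) \<in> borel_measurable borel" if [measurable]: "u \<in> borel_measurable borel" for u :: "real \<Rightarrow> ennreal"
  proof -
    have "(\<lambda>l. emeasure lborel {x\<in>space lborel. ennreal l < u x}) \<in> borel_measurable borel"
      by measurable
    then show ?thesis by simp
  qed
  have "(\<integral>\<^sup>+x. f x \<partial>lborel) + (\<integral>\<^sup>+x. g x \<partial>lborel) = (\<integral>\<^sup>+l. ?L f l + ?L g l \<partial>lborel)"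
    by (subst (1 2) nn_integral_layer_cake_le_1) (auto simp: le1 nn_integral_add)
  also have "\<dots> \<le> (\<integral>\<^sup>+l. 2 * ?L ?h l \<partial>lborel)"
    by (intro nn_integral_mono level)
  also have "\<dots> = 2 * (\<integral>\<^sup>+l. ?L ?h l \<partial>lborel)"
    by (rule nn_integral_cmult) measurable
  also have "\<dots> = 2 * (\<integral>\<^sup>+x. ?h x \<partial>lborel)"
    by (subst nn_integral_layer_cake_le_1[of ?h]) auto
  also have "\<dots> \<le> 2 * (\<integral>\<^sup>+x. h x \<partial>lborel)"
    by (intro mult_left_mono nn_integral_mono) auto
  finally show ?thesis by (rule ennreal_mult_le_power2)
qed

lemma prekopa_leindler_bounded:
  fixes f g h :: "real \<Rightarrow> ennreal"
  assumes [measurable]: "f \<in> borel_measurable borel" "g \<in> borel_measurable borel" "h \<in> borel_measurable borel"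
    and bd: "(SUP x. f x) < top" "(SUP x. g x) < top"
    and mid: "\<And>x y. f x * g y \<le> (h ((x + y) / 2))\<^sup>2"
  shows "(\<integral>\<^sup>+x. f x \<partial>lborel) * (\<integral>\<^sup>+x. g x \<partial>lborel) \<le> (\<integral>\<^sup>+x. h x \<partial>lborel)\<^sup>2"
proof (cases "(SUP x. f x) = 0 \<or> (SUP x. g x) = 0")
  case True
  then have "(\<forall>x. f x = 0) \<or> (\<forall>x. g x = 0)" by (auto simp: SUP_eq_iff bot_ennreal)
  then show ?thesis by auto
next
  case False
  define F where "F = enn2real (SUP x. f x)"
  define G where "G = enn2real (SUP x. g x)"
  have F: "(SUP x. f x) = ennreal F" and G: "(SUP x. g x) = ennreal G"
    using bd by (auto simp: F_def G_def)
  have pos: "0 < F" "0 < G"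
    using False by (auto simp: F G ennreal_eq_0_iff not_le)
  \<comment> \<open>Replacing \<open>f\<close>, \<open>g\<close>, \<open>h\<close> by
    \<open>f / F\<close>, \<open>g / G\<close>, \<open>c * h\<close> preserves the midpoint
    hypothesis exactly because the square of \<open>c\<close> is \<open>1 / (F * G)\<close>.\<close>
  define c where "c = 1 / sqrt (F * G)"
  have c: "0 < c" "c\<^sup>2 = (1/F) * (1/G)" using pos by (auto simp: c_def power_divide)
  have prod: "ennreal (1/F) * ennreal (1/G) = (ennreal c)\<^sup>2"
    using c pos by (simp add: ennreal_power flip: ennreal_mult)
  have scale: "(ennreal (1/F) * a) * (ennreal (1/G) * b) = (ennreal c)\<^sup>2 * (a * b)" for a b
    by (simp add: prod[symmetric] ac_simps)
  have "(\<integral>\<^sup>+x. ennreal (1/F) * f x \<partial>lborel) * (\<integral>\<^sup>+x. ennreal (1/G) * g x \<partial>lborel)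
      \<le> (\<integral>\<^sup>+x. ennreal c * h x \<partial>lborel)\<^sup>2"
  proof (rule prekopa_leindler_normalized)
    show "(SUP x. ennreal (1/F) * f x) = 1" "(SUP x. ennreal (1/G) * g x) = 1"
      using pos by (simp_all add: F G flip: SUP_mult_left_ennreal ennreal_mult)
    show "ennreal (1/F) * f x * (ennreal (1/G) * g y) \<le> (ennreal c * h ((x + y) / 2))\<^sup>2" for x y
      unfolding scale power_mult_distrib by (intro mult_left_mono mid) simp
  qed measurable
  then have "(ennreal c)\<^sup>2 * ((\<integral>\<^sup>+x. f x \<partial>lborel) * (\<integral>\<^sup>+x. g x \<partial>lborel)) \<le> (ennreal c)\<^sup>2 * (\<integral>\<^sup>+x. h x \<partial>lborel)\<^sup>2"
    by (simp add: nn_integral_cmult scale power_mult_distrib)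
  then show ?thesis
    using c by (subst (asm) ennreal_mult_le_mult_iff) (auto simp: ennreal_power power2_eq_square ennreal_mult_eq_top_iff)
qed

lemma nn_integral_SUP_min:
  assumes [measurable]: "f \<in> borel_measurable M"
  shows "(SUP n::nat. \<integral>\<^sup>+x. min (f x) (of_nat n) \<partial>M) = (\<integral>\<^sup>+x. f x \<partial>M)"
proof -
  have "(SUP n::nat. min u (of_nat n)) = (u::ennreal)" for u
  proof -
    have "(SUP n::nat. min u (of_nat n)) = inf u (SUP n::nat. of_nat n)"
      unfolding inf_min[symmetric] by (rule inf_SUP[symmetric])
    then show ?thesis by (simp add: ennreal_SUP_of_nat_eq_top)
  qed
  then have "(\<integral>\<^sup>+x. f x \<partial>M) = (\<integral>\<^sup>+x. (SUP n::nat. min (f x) (of_nat n)) \<partial>M)" by simp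
  also have "\<dots> = (SUP n::nat. \<integral>\<^sup>+x. min (f x) (of_nat n) \<partial>M)"
    by (rule nn_integral_monotone_convergence_SUP) (auto simp: incseq_def le_fun_def intro: min.coboundedI2)
  finally show ?thesis ..
qed

text \<open>Truncating \<open>f\<close> and \<open>g\<close>, but not \<open>h\<close>, preserves
  the midpoint hypothesis because it only lowers the left-hand side. Monotone convergence then
  removes the two bounds independently.\<close>

lemma prekopa_leindler_real:
  fixes f g h :: "real \<Rightarrow> ennreal"
  assumes [measurable]: "f \<in> borel_measurable borel" "g \<in> borel_measurable borel" "h \<in> borel_measurable borel"
    and mid: "\<And>x y. f x * g y \<le> (h ((x + y) / 2))\<^sup>2"
  shows "(\<integral>\<^sup>+x. f x \<partial>lborel) * (\<integral>\<^sup>+x. g x \<partial>lborel) \<le> (\<integral>\<^sup>+x. h x \<partial>lborel)\<^sup>2"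
proof -
  let ?t = "\<lambda>(u::real\<Rightarrow>ennreal) (n::nat). \<integral>\<^sup>+x. min (u x) (of_nat n) \<partial>lborel"
  have "?t f m * ?t g n \<le> (\<integral>\<^sup>+x. h x \<partial>lborel)\<^sup>2" for m n
  proof (rule prekopa_leindler_bounded)
    have "(SUP x. min (u x) (of_nat n)) \<le> of_nat n" for u :: "real \<Rightarrow> ennreal" and n :: nat
      by (intro SUP_least) simp
    then show "(SUP x. min (f x) (of_nat m)) < top" "(SUP x. min (g x) (of_nat n)) < top"
      using of_nat_less_top le_less_trans by blast+
    fix x y
    have "min (f x) (of_nat m) * min (g y) (of_nat n) \<le> f x * g y" by (intro mult_mono) auto
    also note mid
    finally show "min (f x) (of_nat m) * min (g y) (of_nat n) \<le> (h ((x + y) / 2))\<^sup>2" .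
  qed measurable
  then have "(SUP m. SUP n. ?t f m * ?t g n) \<le> (\<integral>\<^sup>+x. h x \<partial>lborel)\<^sup>2"
    by (intro SUP_least)
  then show ?thesis
    by (simp add: nn_integral_SUP_min flip: SUP_mult_left_ennreal SUP_mult_right_ennreal)
qed

text \<open>Tensorisation: for values \<open>a\<close>, \<open>b\<close> of a new coordinate, the
  induction hypothesis for the slices of \<open>f\<close> at \<open>a\<close>, of \<open>g\<close>
  at \<open>b\<close> and of \<open>h\<close> at \<open>(a + b) / 2\<close> is precisely the
  midpoint hypothesis of the one-dimensional inequality for the partial integrals.\<close>

lemma prekopa_leindler_PiM:
  fixes f g h :: "('i \<Rightarrow> real) \<Rightarrow> ennreal"
  assumes "finite I"
    and "f \<in> borel_measurable (Pi\<^sub>M I (\<lambda>_. lborel))" "g \<in> borel_measurable (Pi\<^sub>M I (\<lambda>_. lborel))"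
      "h \<in> borel_measurable (Pi\<^sub>M I (\<lambda>_. lborel))"
    and "\<And>x y. x \<in> extensional I \<Longrightarrow> y \<in> extensional I \<Longrightarrow> f x * g y \<le> (h (\<lambda>i\<in>I. (x i + y i) / 2))\<^sup>2"
  shows "(\<integral>\<^sup>+x. f x \<partial>Pi\<^sub>M I (\<lambda>_. lborel)) * (\<integral>\<^sup>+x. g x \<partial>Pi\<^sub>M I (\<lambda>_. lborel))
      \<le> (\<integral>\<^sup>+x. h x \<partial>Pi\<^sub>M I (\<lambda>_. lborel))\<^sup>2"
  using assms
proof (induction I arbitrary: f g h rule: finite_induct)
  case empty
  interpret product_sigma_finite "\<lambda>_::'i. lborel :: real measure" ..
  \<comment> \<open>The empty product is a point mass at the function that is
    \<open>undefined\<close> everywhere, so the claim is the hypothesis at that point.\<close>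
  show ?case using empty(4)[of "\<lambda>_. undefined" "\<lambda>_. undefined"]
    by (simp add: nn_integral_empty restrict_def)
next
  case (insert i I)
  interpret product_sigma_finite "\<lambda>_::'i. lborel :: real measure" ..
  note [measurable] = insert.prems(1-3)
  interpret I: finite_product_sigma_finite "\<lambda>_. lborel :: real measure" I
    by standard (rule insert(1))
  have slice_measurable: "(\<lambda>a. \<integral>\<^sup>+x. u (x(i := a)) \<partial>Pi\<^sub>M I (\<lambda>_. lborel)) \<in> borel_measurable borel"
    if [measurable]: "u \<in> borel_measurable (Pi\<^sub>M (insert i I) (\<lambda>_. lborel))" for u :: "('i \<Rightarrow> real) \<Rightarrow> ennreal"
    by (rule I.borel_measurable_nn_integral) measurable
  have upd: "x(i := a) \<in> extensional (insert i I)" if "x \<in> extensional I" for x :: "'i \<Rightarrow> real" and a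
    using that by (auto simp: extensional_def)
  show ?case
    unfolding product_nn_integral_insert_rev[OF insert(1,2) insert.prems(1)]
      product_nn_integral_insert_rev[OF insert(1,2) insert.prems(2)]
      product_nn_integral_insert_rev[OF insert(1,2) insert.prems(3)]
  proof (rule prekopa_leindler_real)
    fix a b :: real
    show "(\<integral>\<^sup>+x. f (x(i := a)) \<partial>Pi\<^sub>M I (\<lambda>_. lborel)) * (\<integral>\<^sup>+x. g (x(i := b)) \<partial>Pi\<^sub>M I (\<lambda>_. lborel))
        \<le> (\<integral>\<^sup>+x. h (x(i := (a + b) / 2)) \<partial>Pi\<^sub>M I (\<lambda>_. lborel))\<^sup>2"
    proof (rule insert.IH)
      fix x y :: "'i \<Rightarrow> real" assume xy: "x \<in> extensional I" "y \<in> extensional I"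
      have "(\<lambda>j\<in>insert i I. ((x(i := a)) j + (y(i := b)) j) / 2) = (\<lambda>j\<in>I. (x j + y j) / 2)(i := (a + b) / 2)"
        using insert(2) by (auto simp: fun_eq_iff)
      with insert.prems(4)[OF upd[OF xy(1)] upd[OF xy(2)], of a b]
      show "f (x(i := a)) * g (y(i := b)) \<le> (h ((\<lambda>j\<in>I. (x j + y j) / 2)(i := (a + b) / 2)))\<^sup>2"
        by (simp only:)
    qed (use insert(2) in measurable)
  qed (auto intro: slice_measurable insert.prems(1-3))
qed

theorem prekopa_leindler:
  fixes f g h :: "'a::euclidean_space \<Rightarrow> ennreal"
  assumes [measurable]: "f \<in> borel_measurable borel" "g \<in> borel_measurable borel" "h \<in> borel_measurable borel"
    and mid: "\<And>x y. f x * g y \<le> (h ((1/2) *\<^sub>R (x + y)))\<^sup>2"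
  shows "(\<integral>\<^sup>+x. f x \<partial>lborel) * (\<integral>\<^sup>+x. g x \<partial>lborel) \<le> (\<integral>\<^sup>+x. h x \<partial>lborel)\<^sup>2"
proof -
  let ?T = "\<lambda>x::'a \<Rightarrow> real. \<Sum>b\<in>Basis. x b *\<^sub>R b"
  have *: "(\<integral>\<^sup>+x. u x \<partial>lborel) = (\<integral>\<^sup>+x. u (?T x) \<partial>Pi\<^sub>M Basis (\<lambda>_. lborel))"
    if [measurable]: "u \<in> borel_measurable borel" for u :: "'a \<Rightarrow> ennreal"
    by (subst lborel_eq) (simp add: nn_integral_distr)
  show ?thesis
    unfolding *[OF assms(1)] *[OF assms(2)] *[OF assms(3)]
  proof (rule prekopa_leindler_PiM)
    fix x y :: "'a \<Rightarrow> real"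
    have "(1/2) *\<^sub>R (?T x + ?T y) = ?T (\<lambda>i\<in>Basis. (x i + y i) / 2)"
      by (simp add: sum.distrib[symmetric] scaleR_sum_right scaleR_add_left add_divide_distrib scaleR_add_right)
    with mid[of "?T x" "?T y"]
    show "f (?T x) * g (?T y) \<le> (h (?T (\<lambda>i\<in>Basis. (x i + y i) / 2)))\<^sup>2" by simp
  qed measurable
qed

section \<open>Hausdorff measure on a hyperplane\<close>

lemma diameter_translation:
  fixes S :: "'a::real_normed_vector set"
  shows "diameter ((+) c ` S) = diameter S"
proof -
  have "(+) c ` S \<times> (+) c ` S = map_prod ((+) c) ((+) c) ` (S \<times> S)" by auto
  then have "(\<lambda>(x, y). dist x y) ` ((+) c ` S \<times> (+) c ` S) = (\<lambda>(x, y). dist x y) ` (S \<times> S)"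
    by (simp add: image_image split_def)
  then show ?thesis by (simp add: diameter_def)
qed

text \<open>Translating a cover changes neither diameters nor weights. Translating back by
  \<open>- c\<close> will give the reverse inequality.\<close>

lemma hausdorff_outer_translation_le:
  fixes A :: "'a::real_normed_vector set"
  shows "hausdorff_outer d ((+) c ` A) \<le> hausdorff_outer d A"
  unfolding hausdorff_outer_def
proof (rule SUP_mono)
  fix \<delta> :: real assume "\<delta> \<in> {0<..}"
  moreover have "hausdorff_content d \<delta> ((+) c ` A) \<le> hausdorff_content d \<delta> A"
    unfolding hausdorff_content_def[of d \<delta> A]
  proof (rule INF_greatest)
    fix U assume "U \<in> hausdorff_covers \<delta> A"
    then have "(\<lambda>i. (+) c ` U i) \<in> hausdorff_covers \<delta> ((+) c ` A)"
      by (auto simp: hausdorff_covers_def diameter_translation bounded_translation image_UN[symmetric])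
    then have "hausdorff_content d \<delta> ((+) c ` A) \<le> (\<Sum>i. hausdorff_weight d ((+) c ` U i))"
      unfolding hausdorff_content_def by (rule INF_lower)
    then show "hausdorff_content d \<delta> ((+) c ` A) \<le> (\<Sum>i. hausdorff_weight d (U i))"
      by (simp add: hausdorff_weight_def diameter_translation cong: if_cong)
  qed
  ultimately show "\<exists>\<epsilon>\<in>{0<..}. hausdorff_content d \<delta> ((+) c ` A) \<le> hausdorff_content d \<epsilon> A"
    by blast
qed

lemma hausdorff_outer_translation:
  fixes A :: "'a::real_normed_vector set"
  shows "hausdorff_outer d ((+) c ` A) = hausdorff_outer d A"
  using hausdorff_outer_translation_le[of d c A] hausdorff_outer_translation_le[of d "- c" "(+) c ` A"]
  by (simp add: image_image)

lemma distr_hausdorff_plus: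
  fixes c :: "'a::{real_normed_vector, second_countable_topology}"
  shows "distr (hausdorff_measure d) borel ((+) c) = hausdorff_measure d"
proof (rule measure_eqI)
  fix A assume "A \<in> sets (distr (hausdorff_measure d) borel ((+) c))"
  then have [measurable]: "A \<in> sets borel" by simp
  have "(+) c -` A = (+) (- c) ` A" by force
  moreover have "(+) c -` A \<in> sets borel" 
    by (rule measurable_sets_borel) measurable
  ultimately show "emeasure (distr (hausdorff_measure d) borel ((+) c)) A = emeasure (hausdorff_measure d) A"
    using hausdorff_outer_translation[of d "- c" A]
    by (subst emeasure_distr) (auto simp: emeasure_hausdorff)
qed simp

lemma nn_integral_hausdorff_translation:
  fixes c :: "'a::{real_normed_vector, second_countable_topology}"
  assumes [measurable]: "u \<in> borel_measurable borel"
  shows "(\<integral>\<^sup>+x. u (c + x) \<partial>hausdorff_measure d) = (\<integral>\<^sup>+x. u x \<partial>hausdorff_measure d)"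
  by (subst (2) distr_hausdorff_plus[of d c, symmetric]) (simp add: nn_integral_distr)

section \<open>Local finiteness of Hausdorff measure on a hyperplane\<close>

lemma hausdorff_content_le_finite_cover:
  assumes W: "finite W" "A \<subseteq> (\<Union>m\<in>W. U m)"
    and U: "\<And>m. m \<in> W \<Longrightarrow> bounded (U m) \<and> diameter (U m) \<le> \<rho>" and \<rho>: "0 \<le> \<rho>" "\<rho> \<le> \<delta>"
  shows "hausdorff_content d \<delta> A \<le> ennreal (real (card W) * (unit_ball_vol (real d) * (\<rho> / 2) ^ d))"
proof -
  obtain h where h: "bij_betw h {0..<card W} W"
    using ex_bij_betw_nat_finite[OF W(1)] by blast
  \<comment> \<open>Covers are sequences, so the finite family is padded with empty sets, whose
    weight is 0 even for \<open>d = 0\<close>.\<close>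
  define V where "V i = (if i < card W then U (h i) else {})" for i
  have hW: "h i \<in> W" if "i < card W" for i
    using h that by (auto simp: bij_betw_def)
  have "A \<subseteq> (\<Union>i. V i)"
  proof
    fix x assume "x \<in> A"
    then obtain m where "m \<in> W" "x \<in> U m" using W(2) by auto
    moreover obtain i where "i < card W" "h i = m"
      using bij_betw_imp_surj_on[OF h] \<open>m \<in> W\<close> by (metis atLeastLessThan_iff imageE)
    ultimately show "x \<in> (\<Union>i. V i)" by (auto simp: V_def)
  qed
  then have "V \<in> hausdorff_covers \<delta> A"
    using U[OF hW] \<rho> by (auto simp: hausdorff_covers_def V_def intro: order_trans)
  then have "hausdorff_content d \<delta> A \<le> (\<Sum>i. hausdorff_weight d (V i))"
    unfolding hausdorff_content_def by (rule INF_lower)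
  also have "\<dots> = (\<Sum>i<card W. hausdorff_weight d (V i))"
    by (rule suminf_finite) (auto simp: V_def)
  also have "\<dots> \<le> of_nat (card {..<card W}) * ennreal (unit_ball_vol (real d) * (\<rho> / 2) ^ d)"
  proof (rule sum_bounded_above)
    fix i assume "i \<in> {..<card W}"
    then have "bounded (V i)" "diameter (V i) \<le> \<rho>" using U[OF hW] by (auto simp: V_def)
    then show "hausdorff_weight d (V i) \<le> ennreal (unit_ball_vol (real d) * (\<rho> / 2) ^ d)"
      unfolding hausdorff_weight_def
      by (auto intro!: ennreal_leI mult_left_mono power_mono diameter_ge_0 simp: unit_ball_vol_nonneg)
  qed
  finally show ?thesis by (simp add: ennreal_mult' ennreal_of_nat_eq_real_of_nat)
qed

text \<open>Cubes of side \<open>L / N\<close> in the coordinates other than \<open>k\<close> cover the hyperplane by \<open>O(N ^ (n - 1))\<close> sets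
  of diameter \<open>O(1 / N)\<close>, because \<open>\<eta> $ k \<noteq> 0\<close> makes the \<open>k\<close>-th coordinate a Lipschitz function of the others.\<close>

lemma hausdorff_outer_hyperplane_finite:
  fixes \<eta> :: "real^'n"
  assumes "\<eta> \<noteq> 0" and L: "0 < L"
  shows "hausdorff_outer (CARD('n) - 1) ({x. \<eta> \<bullet> x = 0} \<inter> cball 0 L) < \<infinity>"
proof -
  obtain k where k: "\<eta> $ k \<noteq> 0" using assms(1) by (auto simp: vec_eq_iff)
  define J where "J = UNIV - {k}"
  define d where "d = CARD('n) - 1"
  have J: "finite J" "card J = d" by (simp_all add: J_def d_def)
  \<comment> \<open>The norm is bounded by the l1 norm. The first summand accounts for coordinate
    \<open>k\<close>, solved from the equation of the hyperplane, the second for the other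
    \<open>d\<close> coordinates.\<close>
  define K where "K = (\<Sum>i\<in>J. \<bar>\<eta> $ i\<bar>) / \<bar>\<eta> $ k\<bar> + real d"
  have K0: "0 \<le> K" by (simp add: K_def sum_nonneg)
  have lip: "norm z \<le> K * \<epsilon>" if z: "\<eta> \<bullet> z = 0" "\<And>i. i \<in> J \<Longrightarrow> \<bar>z $ i\<bar> \<le> \<epsilon>" for z \<epsilon>
  proof -
    have split: "(\<Sum>i\<in>UNIV. w i) = w k + (\<Sum>i\<in>J. w i)" for w :: "'n \<Rightarrow> real"
      unfolding J_def by (rule sum.remove) auto
    have "\<eta> $ k * z $ k = - (\<Sum>i\<in>J. \<eta> $ i * z $ i)"
      using z(1) by (simp add: inner_vec_def split)
    then have "\<bar>\<eta> $ k\<bar> * \<bar>z $ k\<bar> = \<bar>\<Sum>i\<in>J. \<eta> $ i * z $ i\<bar>"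
      by (simp flip: abs_mult)
    also have "\<dots> \<le> (\<Sum>i\<in>J. \<bar>\<eta> $ i\<bar> * \<epsilon>)"
      by (rule order_trans[OF sum_abs]) (auto simp: abs_mult intro!: sum_mono mult_left_mono z)
    finally have "\<bar>z $ k\<bar> \<le> (\<Sum>i\<in>J. \<bar>\<eta> $ i\<bar>) / \<bar>\<eta> $ k\<bar> * \<epsilon>"
      using k by (simp add: field_simps sum_distrib_right[symmetric] sum_distrib_left[symmetric])
    moreover have "(\<Sum>i\<in>J. \<bar>z $ i\<bar>) \<le> real d * \<epsilon>"
      using sum_mono[of J "\<lambda>i. \<bar>z $ i\<bar>" "\<lambda>_. \<epsilon>"] z(2) J by simp
    moreover have "norm z \<le> (\<Sum>i\<in>UNIV. \<bar>z $ i\<bar>)" by (rule norm_le_l1_cart)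
    ultimately show ?thesis unfolding split K_def by (simp add: algebra_simps)
  qed
  \<comment> \<open>At mesh \<open>L / N\<close> there are at most \<open>(3 * N) ^ d\<close> sets
    of diameter at most \<open>K * L / N\<close>. The powers of \<open>N\<close> cancel, so one
    bound serves every \<open>\<delta>\<close>.\<close>
  define C where "C = 3 ^ d * (unit_ball_vol (real d) * (K * L / 2) ^ d)"
  have "hausdorff_content d \<delta> ({x. \<eta> \<bullet> x = 0} \<inter> cball 0 L) \<le> ennreal C" if \<delta>: "0 < \<delta>" for \<delta>
  proof -
    obtain N0 :: nat where N0: "K * L / \<delta> < real N0" using reals_Archimedean2 by blast
    \<comment> \<open>Forcing \<open>1 \<le> N\<close> gives \<open>2 * N + 1 \<le> 3 * N\<close>,
      the origin of the factor \<open>3 ^ d\<close>.\<close>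
    define N where "N = max N0 1"
    define \<epsilon> where "\<epsilon> = L / real N"
    have N: "1 \<le> N" "K * L / \<delta> < real N" using N0 by (auto simp: N_def)
    then have \<epsilon>: "0 < \<epsilon>" "K * \<epsilon> \<le> \<delta>"
      using L \<delta> by (auto simp: \<epsilon>_def field_simps)
    \<comment> \<open>The index \<open>N\<close> is attained by a coordinate equal to
      \<open>L\<close>; hence \<open>2 * N + 1\<close> indices per coordinate.\<close>
    define W where "W = (\<Pi>\<^sub>E i\<in>J. {- int N..int N})"
    define U where "U m = {x. \<eta> \<bullet> x = 0 \<and> (\<forall>i\<in>J. of_int (m i) * \<epsilon> \<le> x $ i \<and> x $ i \<le> (of_int (m i) + 1) * \<epsilon>)}"
      for m :: "'n \<Rightarrow> int"
    have cardW: "card W = (2 * N + 1) ^ d"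
      using J by (simp add: W_def card_PiE nat_add_distrib nat_mult_distrib)
    have close: "norm (x - y) \<le> K * \<epsilon>" if "x \<in> U m" "y \<in> U m" for x y m
    proof (rule lip)
      show "\<eta> \<bullet> (x - y) = 0" using that by (simp add: U_def inner_diff_right)
      fix i assume "i \<in> J"
      then have "of_int (m i) * \<epsilon> \<le> x $ i" "x $ i \<le> of_int (m i) * \<epsilon> + \<epsilon>"
        "of_int (m i) * \<epsilon> \<le> y $ i" "y $ i \<le> of_int (m i) * \<epsilon> + \<epsilon>"
        using that by (auto simp: U_def algebra_simps)
      then show "\<bar>(x - y) $ i\<bar> \<le> \<epsilon>" by simp
    qed
    have "hausdorff_content d \<delta> ({x. \<eta> \<bullet> x = 0} \<inter> cball 0 L)
        \<le> ennreal (real (card W) * (unit_ball_vol (real d) * (K * \<epsilon> / 2) ^ d))"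
    proof (rule hausdorff_content_le_finite_cover)
      show "finite W" using J by (simp add: W_def finite_PiE)
      show "{x. \<eta> \<bullet> x = 0} \<inter> cball 0 L \<subseteq> (\<Union>m\<in>W. U m)"
      proof
        fix x assume x: "x \<in> {x. \<eta> \<bullet> x = 0} \<inter> cball 0 L"
        define m where "m = (\<lambda>i\<in>J. \<lfloor>x $ i / \<epsilon>\<rfloor>)"
        have "\<lfloor>x $ i / \<epsilon>\<rfloor> \<in> {- int N..int N}" for i
        proof -
          have "\<bar>x $ i\<bar> \<le> L" using x component_le_norm_cart[of x i] by simp
          also have "L = real N * \<epsilon>" using N by (simp add: \<epsilon>_def)
          finally have "- real N \<le> x $ i / \<epsilon>" "x $ i / \<epsilon> \<le> real N"
            using \<epsilon>(1) by (auto simp: field_simps abs_le_iff)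
          then show ?thesis by (simp add: le_floor_iff) linarith
        qed
        then have "m \<in> W" by (auto simp: m_def W_def)
        moreover have "x \<in> U m"
        proof -
          have "of_int \<lfloor>x $ i / \<epsilon>\<rfloor> * \<epsilon> \<le> x $ i \<and> x $ i \<le> (of_int \<lfloor>x $ i / \<epsilon>\<rfloor> + 1) * \<epsilon>" for i
            using \<epsilon>(1) by (simp add: floor_divide_lower floor_divide_upper less_imp_le)
          then show ?thesis using x by (simp add: U_def m_def)
        qed
        ultimately show "x \<in> (\<Union>m\<in>W. U m)" by blast
      qed
      fix m
      have "bounded (U m)"
      proof (cases "U m = {}")
        case False
        then obtain y where "y \<in> U m" by auto
        then have "U m \<subseteq> cball y (K * \<epsilon>)" using close by (auto simp: dist_norm)
        then show ?thesis using bounded_subset bounded_cball by blast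
      qed simp
      moreover have "diameter (U m) \<le> K * \<epsilon>"
        using K0 \<epsilon> close by (intro diameter_le) auto
      ultimately show "bounded (U m) \<and> diameter (U m) \<le> K * \<epsilon>" ..
    qed (use K0 \<epsilon> in auto)
    also have "\<dots> \<le> ennreal C"
    proof (rule ennreal_leI)
      have "real (card W) = (2 * real N + 1) ^ d" by (simp add: cardW add.commute)
      also have "\<dots> \<le> (3 * real N) ^ d" using N by (intro power_mono) auto
      finally have "real (card W) * (unit_ball_vol (real d) * (K * \<epsilon> / 2) ^ d)
          \<le> (3 * real N) ^ d * (unit_ball_vol (real d) * (K * \<epsilon> / 2) ^ d)"
        using K0 \<epsilon> by (intro mult_right_mono) (auto simp: unit_ball_vol_nonneg)
      also have "\<dots> = C" using N by (simp add: C_def \<epsilon>_def power_mult_distrib power_divide)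
      finally show "real (card W) * (unit_ball_vol (real d) * (K * \<epsilon> / 2) ^ d) \<le> C" .
    qed
    finally show ?thesis .
  qed
  then have "hausdorff_outer d ({x. \<eta> \<bullet> x = 0} \<inter> cball 0 L) \<le> ennreal C"
    unfolding hausdorff_outer_def by (intro SUP_least) simp
  also have "\<dots> < \<infinity>" by simp
  finally show ?thesis by (simp add: d_def)
qed

section \<open>Uniqueness of translation-invariant measures on a subspace\<close>

lemma sigma_finite_measure_cball:
  fixes \<mu> :: "'a::euclidean_space measure"
  assumes "sets \<mu> = sets borel" and fin: "\<And>L. 0 < L \<Longrightarrow> emeasure \<mu> (cball 0 L) < \<infinity>"
  shows "sigma_finite_measure \<mu>"
proof
  have "(\<Union>n. cball 0 (real (Suc n))) = (UNIV :: 'a set)"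
  proof safe
    fix x :: 'a
    obtain n where "norm x \<le> real n" using real_arch_simple by blast
    then show "x \<in> (\<Union>n. cball 0 (real (Suc n)))" by (intro UN_I[of n]) auto
  qed simp
  moreover have "space \<mu> = UNIV" using sets_eq_imp_space_eq[OF assms(1)] by simp
  ultimately show "\<exists>A. countable A \<and> A \<subseteq> sets \<mu> \<and> \<Union>A = space \<mu> \<and> (\<forall>a\<in>A. emeasure \<mu> a \<noteq> \<infinity>)"
    using fin by (intro exI[of _ "range (\<lambda>n. cball 0 (real (Suc n)))"]) (auto simp: assms(1) less_top[symmetric] simp del: of_nat_Suc)
qed

text \<open>The Fubini argument behind the uniqueness of Haar measure.\<close>

lemma invariant_measures_proportional:
  fixes \<mu> \<nu> :: "'a::euclidean_space measure" and a b :: "'a \<Rightarrow> ennreal"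
  assumes "sigma_finite_measure \<mu>" "sigma_finite_measure \<nu>"
    and [measurable_cong]: "sets \<mu> = sets borel" "sets \<nu> = sets borel"
    and V: "subspace V" "AE x in \<mu>. x \<in> V" "AE x in \<nu>. x \<in> V"
    and inv_\<mu>: "\<And>u v. u \<in> borel_measurable borel \<Longrightarrow> v \<in> V \<Longrightarrow> (\<integral>\<^sup>+x. u (v + x) \<partial>\<mu>) = (\<integral>\<^sup>+x. u x \<partial>\<mu>)"
    and inv_\<nu>: "\<And>u v. u \<in> borel_measurable borel \<Longrightarrow> v \<in> V \<Longrightarrow> (\<integral>\<^sup>+x. u (v + x) \<partial>\<nu>) = (\<integral>\<^sup>+x. u x \<partial>\<nu>)"
    and [measurable]: "a \<in> borel_measurable borel" "b \<in> borel_measurable borel"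
  shows "(\<integral>\<^sup>+x. a x \<partial>\<mu>) * (\<integral>\<^sup>+x. b x \<partial>\<nu>) = (\<integral>\<^sup>+x. b x \<partial>\<mu>) * (\<integral>\<^sup>+x. a (- x) \<partial>\<nu>)"
proof -
  interpret \<mu>: sigma_finite_measure \<mu> by fact
  interpret \<nu>: sigma_finite_measure \<nu> by fact
  interpret pair_sigma_finite \<nu> \<mu> ..
  have "(\<integral>\<^sup>+x. a x \<partial>\<mu>) * (\<integral>\<^sup>+y. b y \<partial>\<nu>) = (\<integral>\<^sup>+x. a x * (\<integral>\<^sup>+y. b y \<partial>\<nu>) \<partial>\<mu>)"
    by (simp add: nn_integral_multc)
  \<comment> \<open>For \<open>x\<close> in \<open>V\<close>, invariance of \<open>\<nu>\<close>
    allows the shift by \<open>x\<close>, which couples the two variables.\<close>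
  also have "\<dots> = (\<integral>\<^sup>+x. (\<integral>\<^sup>+y. a x * b (x + y) \<partial>\<nu>) \<partial>\<mu>)"
    using V(2) by (intro nn_integral_cong_AE) (auto simp: inv_\<nu> nn_integral_cmult)
  also have "\<dots> = (\<integral>\<^sup>+y. (\<integral>\<^sup>+x. a x * b (x + y) \<partial>\<mu>) \<partial>\<nu>)"
    by (rule Fubini') measurable
  also have "\<dots> = (\<integral>\<^sup>+y. (\<integral>\<^sup>+x. a (x - y) * b x \<partial>\<mu>) \<partial>\<nu>)"
  \<comment> \<open>Invariance of \<open>\<mu>\<close> under \<open>y\<close> moves the shift from
    \<open>b\<close> to \<open>a\<close>.\<close>
  proof (rule nn_integral_cong_AE, use V(3) in eventually_elim)
    fix y assume "y \<in> V"
    from inv_\<mu>[OF _ this, of "\<lambda>x. a (x - y) * b x"]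
    show "(\<integral>\<^sup>+x. a x * b (x + y) \<partial>\<mu>) = (\<integral>\<^sup>+x. a (x - y) * b x \<partial>\<mu>)"
      by (simp add: add.commute)
  qed
  also have "\<dots> = (\<integral>\<^sup>+x. (\<integral>\<^sup>+y. a (x - y) * b x \<partial>\<nu>) \<partial>\<mu>)"
    by (rule Fubini'[symmetric]) measurable
  also have "\<dots> = (\<integral>\<^sup>+x. b x * (\<integral>\<^sup>+y. a (- y) \<partial>\<nu>) \<partial>\<mu>)"
  \<comment> \<open>Invariance of \<open>\<nu>\<close> under \<open>- x\<close> removes
    \<open>x\<close> from the argument of \<open>a\<close> and leaves the reflection behind.\<close>
  proof (rule nn_integral_cong_AE, use V(2) in eventually_elim)
    fix x assume "x \<in> V"
    then have "- x \<in> V" using V(1) by (rule subspace_neg[rotated])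
    from inv_\<nu>[OF _ this, of "\<lambda>y. a (- y)"]
    have "(\<integral>\<^sup>+y. a (x - y) \<partial>\<nu>) = (\<integral>\<^sup>+y. a (- y) \<partial>\<nu>)" by simp
    then show "(\<integral>\<^sup>+y. a (x - y) * b x \<partial>\<nu>) = b x * (\<integral>\<^sup>+y. a (- y) \<partial>\<nu>)"
      by (simp add: nn_integral_cmult mult.commute[of _ "b x"])
  qed
  also have "\<dots> = (\<integral>\<^sup>+x. b x \<partial>\<mu>) * (\<integral>\<^sup>+x. a (- x) \<partial>\<nu>)"
    by (simp add: nn_integral_multc)
  finally show ?thesis .
qed

section \<open>Slicing Lebesgue measure\<close>

text \<open>Lebesgue measure on a slab, projected onto the hyperplane \<open>\<eta> \<bullet> x = 0\<close>, turns statements about the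
  hyperplane into statements about \<open>lborel\<close> on the full space, without parametrising the hyperplane.\<close>

definition unit_step :: "'a::euclidean_space \<Rightarrow> 'a" where
  "unit_step \<eta> = (1 / (\<eta> \<bullet> \<eta>)) *\<^sub>R \<eta>"

definition hyperplane_proj :: "'a::euclidean_space \<Rightarrow> 'a \<Rightarrow> 'a" where
  "hyperplane_proj \<eta> x = x - (\<eta> \<bullet> x) *\<^sub>R unit_step \<eta>"

text \<open>Half-open of width 1 in the variable \<open>\<eta> \<bullet> x\<close>: each line in
  direction \<open>\<eta>\<close>, parametrised by multiples of \<open>unit_step \<eta>\<close>,
  meets it in a parameter interval of length 1, so the slicing formula has no constant.\<close>

definition slab :: "'a::euclidean_space \<Rightarrow> 'a set" where
  "slab \<eta> = {x. 0 \<le> \<eta> \<bullet> x \<and> \<eta> \<bullet> x < 1}"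

definition slab_measure :: "'a::euclidean_space \<Rightarrow> 'a measure" where
  "slab_measure \<eta> = distr (density lborel (indicator (slab \<eta>))) borel (hyperplane_proj \<eta>)"

lemma inner_unit_step [simp]: "\<eta> \<noteq> 0 \<Longrightarrow> \<eta> \<bullet> unit_step \<eta> = 1"
  by (simp add: unit_step_def)

lemma inner_hyperplane_proj [simp]: "\<eta> \<noteq> 0 \<Longrightarrow> \<eta> \<bullet> hyperplane_proj \<eta> x = 0"
  by (simp add: hyperplane_proj_def inner_diff_right)

lemma hyperplane_proj_add: "hyperplane_proj \<eta> (x + y) = hyperplane_proj \<eta> x + hyperplane_proj \<eta> y"
  by (simp add: hyperplane_proj_def inner_add_right algebra_simps)

lemma hyperplane_proj_scaleR: "hyperplane_proj \<eta> (c *\<^sub>R x) = c *\<^sub>R hyperplane_proj \<eta> x"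
  by (simp add: hyperplane_proj_def algebra_simps)

lemma hyperplane_proj_eq: "\<eta> \<bullet> x = 0 \<Longrightarrow> hyperplane_proj \<eta> x = x"
  by (simp add: hyperplane_proj_def)

lemma measurable_hyperplane_proj [measurable]: "hyperplane_proj \<eta> \<in> borel_measurable borel"
  unfolding hyperplane_proj_def by measurable

lemma sets_slab [measurable]: "slab \<eta> \<in> sets borel"
  unfolding slab_def by measurable

lemma sets_slab_measure [simp, measurable_cong]: "sets (slab_measure \<eta>) = sets borel"
  by (simp add: slab_measure_def)

lemma space_slab_measure [simp]: "space (slab_measure \<eta>) = UNIV"
  by (simp add: slab_measure_def)

lemma nn_integral_slab_measure:
  assumes [measurable]: "u \<in> borel_measurable borel"
  shows "(\<integral>\<^sup>+x. u x \<partial>slab_measure \<eta>) = (\<integral>\<^sup>+x. indicator (slab \<eta>) x * u (hyperplane_proj \<eta> x) \<partial>lborel)"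
  unfolding slab_measure_def by (simp add: nn_integral_distr nn_integral_density)

lemma emeasure_slab_measure:
  assumes [measurable]: "A \<in> sets borel"
  shows "emeasure (slab_measure \<eta>) A = emeasure lborel {x \<in> slab \<eta>. hyperplane_proj \<eta> x \<in> A}"
proof -
  have [measurable]: "{x \<in> slab \<eta>. hyperplane_proj \<eta> x \<in> A} \<in> sets borel" by measurable
  have "emeasure (slab_measure \<eta>) A
      = (\<integral>\<^sup>+x. indicator (slab \<eta>) x * indicator A (hyperplane_proj \<eta> x) \<partial>lborel)"
    by (subst nn_integral_slab_measure[symmetric]) auto
  also have "\<dots> = (\<integral>\<^sup>+x. indicator {x \<in> slab \<eta>. hyperplane_proj \<eta> x \<in> A} x \<partial>lborel)"
    by (intro nn_integral_cong) (simp split: split_indicator)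
  finally show ?thesis by simp
qed

lemma AE_slab_measure: "\<eta> \<noteq> 0 \<Longrightarrow> AE x in slab_measure \<eta>. \<eta> \<bullet> x = 0"
  unfolding slab_measure_def by (subst AE_distr_iff) auto

lemma nn_integral_lborel_translation:
  fixes c :: "'a::euclidean_space"
  assumes [measurable]: "u \<in> borel_measurable borel"
  shows "(\<integral>\<^sup>+x. u (c + x) \<partial>lborel) = (\<integral>\<^sup>+x. u x \<partial>lborel)"
  by (subst (2) lborel_distr_plus[of c, symmetric]) (simp add: nn_integral_distr)

text \<open>A shift parallel to the hyperplane preserves the slab and commutes with the projection,
  so this is translation invariance of \<open>lborel\<close>.\<close>

lemma nn_integral_slab_measure_translation:
  assumes [measurable]: "u \<in> borel_measurable borel" and v: "\<eta> \<bullet> v = 0"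
  shows "(\<integral>\<^sup>+x. u (v + x) \<partial>slab_measure \<eta>) = (\<integral>\<^sup>+x. u x \<partial>slab_measure \<eta>)"
proof -
  have "(\<integral>\<^sup>+x. u (v + x) \<partial>slab_measure \<eta>)
      = (\<integral>\<^sup>+x. indicator (slab \<eta>) (v + x) * u (hyperplane_proj \<eta> (v + x)) \<partial>lborel)"
    using v by (simp add: nn_integral_slab_measure hyperplane_proj_add hyperplane_proj_eq slab_def
        inner_add_right indicator_def)
  also have "\<dots> = (\<integral>\<^sup>+x. u x \<partial>slab_measure \<eta>)"
    by (simp add: nn_integral_slab_measure
        nn_integral_lborel_translation[where u = "\<lambda>x. indicator (slab \<eta>) x * u (hyperplane_proj \<eta> x)"])
  finally show ?thesis .
qed

lemma emeasure_slab_measure_cball_finite: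
  assumes "\<eta> \<noteq> 0"
  shows "emeasure (slab_measure \<eta>) (cball 0 L) < \<infinity>"
proof -
  let ?S = "{x \<in> slab \<eta>. hyperplane_proj \<eta> x \<in> cball 0 L}"
  have "?S \<subseteq> cball 0 (L + norm (unit_step \<eta>))"
  proof
    fix x assume x: "x \<in> ?S"
    have "norm x \<le> norm (hyperplane_proj \<eta> x) + norm ((\<eta> \<bullet> x) *\<^sub>R unit_step \<eta>)"
      unfolding hyperplane_proj_def by (metis diff_add_cancel norm_triangle_ineq)
    also have "norm ((\<eta> \<bullet> x) *\<^sub>R unit_step \<eta>) \<le> norm (unit_step \<eta>)"
      using x by (auto simp: slab_def intro: mult_left_le_one_le)
    finally show "x \<in> cball 0 (L + norm (unit_step \<eta>))" using x by simp
  qed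
  then have "emeasure lborel ?S < \<infinity>"
    using bounded_subset bounded_cball by (blast intro: emeasure_bounded_finite)
  then show ?thesis by (simp add: emeasure_slab_measure)
qed

text \<open>The constant of proportionality will be found by dividing by this mass.\<close>

lemma emeasure_slab_measure_cball_pos:
  assumes "\<eta> \<noteq> 0"
  shows "0 < emeasure (slab_measure \<eta>) (cball 0 1)"
proof -
  let ?U = "{x. 0 < \<eta> \<bullet> x} \<inter> {x. \<eta> \<bullet> x < 1} \<inter> {x. norm (hyperplane_proj \<eta> x) < 1}"
  \<comment> \<open>This point lies midway between the two faces of the slab and projects to 0, so
    it is interior to the preimage of the ball.\<close>
  let ?c = "(1/2) *\<^sub>R unit_step \<eta>"
  have "continuous_on UNIV (\<lambda>x. norm (hyperplane_proj \<eta> x))"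
    unfolding hyperplane_proj_def by (intro continuous_intros)
  then have "open ?U"
    by (intro open_Int open_halfspace_gt open_halfspace_lt open_Collect_less) (auto intro: continuous_intros)
  moreover have "hyperplane_proj \<eta> ?c = 0" using assms by (simp add: hyperplane_proj_def)
  then have "?c \<in> ?U" using assms by simp
  ultimately obtain r where r: "0 < r" "ball ?c r \<subseteq> ?U" using open_contains_ball by blast
  have "0 < emeasure lborel (ball ?c r)"
    using r(1) by (simp add: emeasure_ball unit_ball_vol_pos)
  also have "\<dots> \<le> emeasure lborel {x \<in> slab \<eta>. hyperplane_proj \<eta> x \<in> cball 0 1}"
    using r(2) by (intro emeasure_mono) (auto simp: slab_def)
  finally show ?thesis by (simp add: emeasure_slab_measure)
qed

lemma sigma_finite_slab_measure: "\<eta> \<noteq> 0 \<Longrightarrow> sigma_finite_measure (slab_measure \<eta>)"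
  by (rule sigma_finite_measure_cball) (use emeasure_slab_measure_cball_finite in auto)

text \<open>Uniqueness of invariant measures settles level 0, and translation by multiples of
  \<open>unit_step \<eta>\<close> carries the result to every other level. Hence \<open>c\<close>,
  the ratio of the two masses of the unit ball, is common to all levels, as the comparison of slices
  at \<open>s - t\<close>, \<open>s\<close> and \<open>s + t\<close> requires.\<close>

lemma nn_integral_hausdorff_hyperplane:
  fixes \<eta> :: "real^'n"
  assumes \<eta>: "\<eta> \<noteq> 0"
  shows "\<exists>c\<ge>0. \<forall>u\<in>borel_measurable borel. \<forall>r.
      (\<integral>\<^sup>+x. indicator {x. \<eta> \<bullet> x = r} x * u x \<partial>hausdorff_measure (CARD('n) - 1))
        = ennreal c * (\<integral>\<^sup>+x. u (x + r *\<^sub>R unit_step \<eta>) \<partial>slab_measure \<eta>)"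
proof -
  let ?H = "hausdorff_measure (CARD('n) - 1) :: (real^'n) measure"
  let ?V = "{x. \<eta> \<bullet> x = 0}"
  \<comment> \<open>The restriction to the hyperplane is essential for Fubini: on the whole space,
    Hausdorff measure of this dimension is not sigma-finite.\<close>
  define \<mu> where "\<mu> = density ?H (indicator ?V)"
  have [simp, measurable_cong]: "sets \<mu> = sets borel" by (simp add: \<mu>_def)
  have int_\<mu>: "(\<integral>\<^sup>+x. u x \<partial>\<mu>) = (\<integral>\<^sup>+x. indicator ?V x * u x \<partial>?H)"
    if [measurable]: "u \<in> borel_measurable borel" for u
    unfolding \<mu>_def by (rule nn_integral_density) measurable
  have fin_\<mu>: "emeasure \<mu> (cball 0 L) < \<infinity>" if "0 < L" for L
  proof -
    have "emeasure \<mu> (cball 0 L) = (\<integral>\<^sup>+x. indicator (cball 0 L) x \<partial>\<mu>)" by simp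
    also have "\<dots> = (\<integral>\<^sup>+x. indicator ?V x * indicator (cball 0 L) x \<partial>?H)"
      by (rule int_\<mu>) (intro borel_measurable_indicator borel_closed closed_cball)
    also have "\<dots> = emeasure ?H (?V \<inter> cball 0 L)"
      by (simp add: indicator_inter_arith[symmetric])
    also have "\<dots> < \<infinity>"
      using hausdorff_outer_hyperplane_finite[OF \<eta> that] by (simp add: emeasure_hausdorff)
    finally show ?thesis .
  qed
  have haar: "(\<integral>\<^sup>+x. a x \<partial>\<mu>) * (\<integral>\<^sup>+x. u x \<partial>slab_measure \<eta>) = (\<integral>\<^sup>+x. u x \<partial>\<mu>) * (\<integral>\<^sup>+x. a (- x) \<partial>slab_measure \<eta>)"
    if [measurable]: "a \<in> borel_measurable borel" "u \<in> borel_measurable borel" for a u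
  proof (rule invariant_measures_proportional)
    show "sigma_finite_measure \<mu>" by (rule sigma_finite_measure_cball) (use fin_\<mu> in auto)
    show "sigma_finite_measure (slab_measure \<eta>)" using \<eta> by (rule sigma_finite_slab_measure)
    show "subspace ?V" by (rule subspace_hyperplane)
    show "AE x in \<mu>. x \<in> ?V" unfolding \<mu>_def by (subst AE_density) (auto simp: indicator_def)
    show "AE x in slab_measure \<eta>. x \<in> ?V" using AE_slab_measure[OF \<eta>] by simp
    fix u :: "real^'n \<Rightarrow> ennreal" and v assume [measurable]: "u \<in> borel_measurable borel" and v: "v \<in> ?V"
    show "(\<integral>\<^sup>+x. u (v + x) \<partial>slab_measure \<eta>) = (\<integral>\<^sup>+x. u x \<partial>slab_measure \<eta>)"
      using v by (intro nn_integral_slab_measure_translation) auto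
    have "(\<integral>\<^sup>+x. u (v + x) \<partial>\<mu>) = (\<integral>\<^sup>+x. indicator ?V (v + x) * u (v + x) \<partial>?H)"
      using v by (simp add: int_\<mu> inner_add_right indicator_def)
    also have "\<dots> = (\<integral>\<^sup>+x. indicator ?V x * u x \<partial>?H)"
      by (rule nn_integral_hausdorff_translation) measurable
    finally show "(\<integral>\<^sup>+x. u (v + x) \<partial>\<mu>) = (\<integral>\<^sup>+x. u x \<partial>\<mu>)" by (simp add: int_\<mu>)
  qed (auto intro: that)
  obtain m where m: "emeasure \<mu> (cball 0 1) = ennreal m" "0 \<le> m"
    using fin_\<mu>[of 1] by (cases "emeasure \<mu> (cball 0 1)") auto
  obtain b where b: "emeasure (slab_measure \<eta>) (cball 0 1) = ennreal b" "0 < b"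
    using emeasure_slab_measure_cball_finite[OF \<eta>, of 1] emeasure_slab_measure_cball_pos[OF \<eta>]
    by (cases "emeasure (slab_measure \<eta>) (cball 0 1)") auto
  have main: "(\<integral>\<^sup>+x. u x \<partial>\<mu>) = ennreal (m / b) * (\<integral>\<^sup>+x. u x \<partial>slab_measure \<eta>)"
    if [measurable]: "u \<in> borel_measurable borel" for u
  proof -
    \<comment> \<open>The ball is symmetric, so testing with it makes the reflection in the
      uniqueness formula disappear.\<close>
    have "(\<lambda>x. indicator (cball 0 1) (- x)) = (indicator (cball 0 1) :: real^'n \<Rightarrow> ennreal)"
      by (simp add: indicator_def fun_eq_iff)
    moreover have "(indicator (cball 0 1) :: real^'n \<Rightarrow> ennreal) \<in> borel_measurable borel"
      by (intro borel_measurable_indicator borel_closed closed_cball)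
    ultimately have "ennreal m * (\<integral>\<^sup>+x. u x \<partial>slab_measure \<eta>) = (\<integral>\<^sup>+x. u x \<partial>\<mu>) * ennreal b"
      using haar[of "indicator (cball 0 1)" u] by (simp add: m b)
    then have "ennreal (1 / b) * (ennreal m * (\<integral>\<^sup>+x. u x \<partial>slab_measure \<eta>))
        = (\<integral>\<^sup>+x. u x \<partial>\<mu>) * (ennreal b * ennreal (1 / b))"
      by (simp add: ac_simps)
    also have "ennreal b * ennreal (1 / b) = 1" using b(2) by (simp flip: ennreal_mult)
    also have "ennreal (1 / b) * (ennreal m * (\<integral>\<^sup>+x. u x \<partial>slab_measure \<eta>))
        = ennreal (m / b) * (\<integral>\<^sup>+x. u x \<partial>slab_measure \<eta>)"
      using b(2) m(2) by (simp add: mult.assoc[symmetric] flip: ennreal_mult)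
    finally show ?thesis by simp
  qed
  show ?thesis
  proof (intro exI[of _ "m / b"] conjI ballI allI)
    show "0 \<le> m / b" using m b by simp
    fix u :: "real^'n \<Rightarrow> ennreal" and r assume [measurable]: "u \<in> borel_measurable borel"
    let ?e = "r *\<^sub>R unit_step \<eta>"
    have "(\<integral>\<^sup>+x. indicator {x. \<eta> \<bullet> x = r} x * u x \<partial>?H)
        = (\<integral>\<^sup>+x. indicator {x. \<eta> \<bullet> x = r} (?e + x) * u (?e + x) \<partial>?H)"
      by (rule nn_integral_hausdorff_translation[symmetric]) measurable
    also have "\<dots> = (\<integral>\<^sup>+x. indicator ?V x * u (x + ?e) \<partial>?H)"
      using \<eta> by (simp add: inner_add_right indicator_def add.commute)
    also have "\<dots> = (\<integral>\<^sup>+x. u (x + ?e) \<partial>\<mu>)"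
      by (rule int_\<mu>[symmetric]) measurable
    finally show "(\<integral>\<^sup>+x. indicator {x. \<eta> \<bullet> x = r} x * u x \<partial>?H)
        = ennreal (m / b) * (\<integral>\<^sup>+x. u (x + ?e) \<partial>slab_measure \<eta>)"
      by (simp add: main)
  qed
qed

text \<open>After Fubini, shifting \<open>r\<close> by \<open>\<eta> \<bullet> x\<close> replaces
  the projection of \<open>x\<close> by \<open>x\<close> itself. A translation in \<open>x\<close>
  then moves \<open>r\<close> into the indicator of the slab, and the values of \<open>r\<close> it
  admits for a given \<open>x\<close> form an interval of length 1.\<close>

lemma nn_integral_lborel_slices:
  fixes u :: "'a::euclidean_space \<Rightarrow> ennreal"
  assumes [measurable]: "u \<in> borel_measurable borel" and \<eta>: "\<eta> \<noteq> 0"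
  shows "(\<integral>\<^sup>+x. u x \<partial>lborel) = (\<integral>\<^sup>+r. (\<integral>\<^sup>+x. u (x + r *\<^sub>R unit_step \<eta>) \<partial>slab_measure \<eta>) \<partial>lborel)"
proof -
  let ?e = "unit_step \<eta>" and ?S = "slab \<eta>"
  have "(\<integral>\<^sup>+r. (\<integral>\<^sup>+x. u (x + r *\<^sub>R ?e) \<partial>slab_measure \<eta>) \<partial>lborel)
      = (\<integral>\<^sup>+r. (\<integral>\<^sup>+x. indicator ?S x * u (hyperplane_proj \<eta> x + r *\<^sub>R ?e) \<partial>lborel) \<partial>lborel)"
    by (simp add: nn_integral_slab_measure)
  also have "\<dots> = (\<integral>\<^sup>+x. (\<integral>\<^sup>+r. indicator ?S x * u (hyperplane_proj \<eta> x + r *\<^sub>R ?e) \<partial>lborel) \<partial>lborel)"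
    by (rule lborel_pair.Fubini'[symmetric]) measurable
  also have "\<dots> = (\<integral>\<^sup>+x. (\<integral>\<^sup>+r. indicator ?S x * u (x + r *\<^sub>R ?e) \<partial>lborel) \<partial>lborel)"
  proof (rule nn_integral_cong)
    fix x
    have "x + r *\<^sub>R ?e = hyperplane_proj \<eta> x + (\<eta> \<bullet> x + r) *\<^sub>R ?e" for r
      by (simp add: hyperplane_proj_def algebra_simps)
    then show "(\<integral>\<^sup>+r. indicator ?S x * u (hyperplane_proj \<eta> x + r *\<^sub>R ?e) \<partial>lborel)
        = (\<integral>\<^sup>+r. indicator ?S x * u (x + r *\<^sub>R ?e) \<partial>lborel)"
      using nn_integral_lborel_translation[of "\<lambda>r. indicator ?S x * u (hyperplane_proj \<eta> x + r *\<^sub>R ?e)" "\<eta> \<bullet> x"]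
      by simp
  qed
  also have "\<dots> = (\<integral>\<^sup>+r. (\<integral>\<^sup>+x. indicator ?S x * u (x + r *\<^sub>R ?e) \<partial>lborel) \<partial>lborel)"
    by (rule lborel_pair.Fubini') measurable
  also have "\<dots> = (\<integral>\<^sup>+r. (\<integral>\<^sup>+x. indicator ?S (x - r *\<^sub>R ?e) * u x \<partial>lborel) \<partial>lborel)"
  proof (rule nn_integral_cong)
    fix r :: real
    show "(\<integral>\<^sup>+x. indicator ?S x * u (x + r *\<^sub>R ?e) \<partial>lborel) = (\<integral>\<^sup>+x. indicator ?S (x - r *\<^sub>R ?e) * u x \<partial>lborel)"
      using nn_integral_lborel_translation[of "\<lambda>x. indicator ?S (x - r *\<^sub>R ?e) * u x" "r *\<^sub>R ?e"]
      by (simp add: add.commute)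
  qed
  also have "\<dots> = (\<integral>\<^sup>+x. (\<integral>\<^sup>+r. indicator ?S (x - r *\<^sub>R ?e) * u x \<partial>lborel) \<partial>lborel)"
    by (rule lborel_pair.Fubini'[symmetric]) measurable
  also have "\<dots> = (\<integral>\<^sup>+x. u x \<partial>lborel)"
  proof (rule nn_integral_cong)
    fix x
    have "indicator ?S (x - r *\<^sub>R ?e) * u x = indicator {\<eta> \<bullet> x - 1<..\<eta> \<bullet> x} r * u x" for r
      using \<eta> by (auto simp: slab_def inner_diff_right indicator_def)
    then show "(\<integral>\<^sup>+r. indicator ?S (x - r *\<^sub>R ?e) * u x \<partial>lborel) = u x"
      by (simp add: nn_integral_multc)
  qed
  finally show ?thesis ..
qed

text \<open>The slab is convex and the projection linear, so both respect midpoints and the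
  inequality on the full space applies. All projected points lie on the hyperplane, where the
  hypothesis is available.\<close>

lemma prekopa_leindler_slab_measure:
  fixes f g h :: "'a::euclidean_space \<Rightarrow> ennreal"
  assumes [measurable]: "f \<in> borel_measurable borel" "g \<in> borel_measurable borel" "h \<in> borel_measurable borel"
    and \<eta>: "\<eta> \<noteq> 0"
    and mid: "\<And>x y. \<eta> \<bullet> x = 0 \<Longrightarrow> \<eta> \<bullet> y = 0 \<Longrightarrow> f x * g y \<le> (h ((1/2) *\<^sub>R (x + y)))\<^sup>2"
  shows "(\<integral>\<^sup>+x. f x \<partial>slab_measure \<eta>) * (\<integral>\<^sup>+x. g x \<partial>slab_measure \<eta>) \<le> (\<integral>\<^sup>+x. h x \<partial>slab_measure \<eta>)\<^sup>2"
  unfolding nn_integral_slab_measure[OF assms(1)] nn_integral_slab_measure[OF assms(2)]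
    nn_integral_slab_measure[OF assms(3)]
proof (rule prekopa_leindler)
  fix x y
  show "indicator (slab \<eta>) x * f (hyperplane_proj \<eta> x) * (indicator (slab \<eta>) y * g (hyperplane_proj \<eta> y))
      \<le> (indicator (slab \<eta>) ((1/2) *\<^sub>R (x + y)) * h (hyperplane_proj \<eta> ((1/2) *\<^sub>R (x + y))))\<^sup>2"
  proof (cases "x \<in> slab \<eta> \<and> y \<in> slab \<eta>")
    case True
    then have "(1/2) *\<^sub>R (x + y) \<in> slab \<eta>" by (auto simp: slab_def inner_add_right)
    then show ?thesis
      using True mid[of "hyperplane_proj \<eta> x" "hyperplane_proj \<eta> y"] \<eta>
      by (simp add: hyperplane_proj_add hyperplane_proj_scaleR)
  qed auto
qed measurable

section \<open>Convex potentials\<close>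

lemma exp_minus_nonneg [simp]: "0 \<le> exp_minus a"
  by (simp add: exp_minus_def)

lemma convex_extendedD:
  assumes "convex_extended f" "0 < u" "u < 1"
  shows "f (u *\<^sub>R x + (1 - u) *\<^sub>R y) \<le> ereal u * f x + ereal (1 - u) * f y"
  using assms by (simp add: convex_extended_def)

lemma convex_extended_finite:
  assumes "convex_extended f" "f x < \<infinity>"
  obtains a where "f x = ereal a"
  using assms by (cases "f x") (auto simp: convex_extended_def)

lemma convex_extended_midpoint:
  assumes "convex_extended f" "f x = ereal a" "f y = ereal b"
  obtains c where "f ((1/2) *\<^sub>R (x + y)) = ereal c" "c \<le> (a + b) / 2"
proof -
  have "f ((1/2) *\<^sub>R (x + y)) \<le> ereal (1/2) * f x + ereal (1 - 1/2) * f y"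
    using convex_extendedD[OF assms(1), of "1/2" x y] by (simp add: scaleR_add_right)
  then have le: "f ((1/2) *\<^sub>R (x + y)) \<le> ereal ((a + b) / 2)"
    by (simp add: assms(2,3) add_divide_distrib)
  then obtain c where "f ((1/2) *\<^sub>R (x + y)) = ereal c"
    using convex_extended_finite[OF assms(1), of "(1/2) *\<^sub>R (x + y)"] by (metis ereal_infty_less(1) ereal_less_eq(1) less_ereal.simps(4) order_le_less_trans)
  with le that show thesis by auto
qed

lemma convex_on_real_of_convex_extended:
  assumes f: "convex_extended f"
  shows "convex_on {x. f x < \<infinity>} (\<lambda>x. real_of_ereal (f x))"
proof -
  have *: "f ((1 - u) *\<^sub>R x + u *\<^sub>R y) < \<infinity> \<and>
      real_of_ereal (f ((1 - u) *\<^sub>R x + u *\<^sub>R y)) \<le> (1 - u) * real_of_ereal (f x) + u * real_of_ereal (f y)"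
    if u: "0 < u" "u < 1" and xy: "f x < \<infinity>" "f y < \<infinity>" for u x y
  proof -
    obtain a where a: "f x = ereal a" using xy(1) by (rule convex_extended_finite[OF f])
    obtain b where b: "f y = ereal b" using xy(2) by (rule convex_extended_finite[OF f])
    have le: "f ((1 - u) *\<^sub>R x + u *\<^sub>R y) \<le> ereal ((1 - u) * a + u * b)"
      using convex_extendedD[OF f, of "1 - u" x y] u by (simp add: a b)
    then have fin: "f ((1 - u) *\<^sub>R x + u *\<^sub>R y) < \<infinity>" by (rule order_le_less_trans) simp
    then obtain c where "f ((1 - u) *\<^sub>R x + u *\<^sub>R y) = ereal c" by (rule convex_extended_finite[OF f])
    with le fin show ?thesis by (simp add: a b)
  qed
  show ?thesis
  proof (rule convex_onI)
    show "convex {x. f x < \<infinity>}"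
      unfolding convex_alt
    proof (intro ballI allI impI)
      fix x y u assume "x \<in> {x. f x < \<infinity>}" "y \<in> {x. f x < \<infinity>}" "0 \<le> u \<and> u \<le> (1::real)"
      then show "(1 - u) *\<^sub>R x + u *\<^sub>R y \<in> {x. f x < \<infinity>}"
        using *[of u x y] by (cases "u = 0 \<or> u = 1") auto
    qed
  qed (use * in auto)
qed

lemma continuous_on_real_of_convex_extended:
  fixes f :: "'a::euclidean_space \<Rightarrow> ereal"
  assumes "convex_extended f" "open {x. f x < \<infinity>}"
  shows "continuous_on {x. f x < \<infinity>} (\<lambda>x. real_of_ereal (f x))"
  using assms by (intro convex_on_continuous convex_on_real_of_convex_extended)

text \<open>A convex function is continuous on its open domain, and off the domain the density is
  0.\<close>

lemma borel_measurable_exp_minus: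
  fixes f :: "'a::euclidean_space \<Rightarrow> ereal"
  assumes f: "convex_extended f" "open {x. f x < \<infinity>}"
  shows "(\<lambda>x. exp_minus (f x)) \<in> borel_measurable borel"
proof -
  have "(\<lambda>x. indicator {x. f x < \<infinity>} x *\<^sub>R exp (- real_of_ereal (f x))) \<in> borel_measurable borel"
    using f by (intro borel_measurable_continuous_on_indicator continuous_intros
        continuous_on_real_of_convex_extended) auto
  also have "(\<lambda>x. indicator {x. f x < \<infinity>} x *\<^sub>R exp (- real_of_ereal (f x))) = (\<lambda>x. exp_minus (f x))"
    by (auto simp: exp_minus_def indicator_def fun_eq_iff)
  finally show ?thesis .
qed

definition defect_set :: "(real^'n \<Rightarrow> ereal) \<Rightarrow> real^'n \<Rightarrow> real \<Rightarrow> real \<Rightarrow> (real^'n) set" where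
  "defect_set f \<eta> D t = {x. f x < \<infinity> \<and> midpoint_defect f \<eta> x t \<ge> ereal D}"

text \<open>The competitors in the infimum are the pairs \<open>x + v\<close>, \<open>x - v\<close>,
  and an infimum is below \<open>D\<close> exactly when some competitor is. With \<open>v\<close>
  independent of \<open>x\<close>, the sublevel set becomes a union over \<open>v\<close> of sets
  defined by real-valued functions.\<close>

lemma midpoint_defect_less_iff:
  fixes f :: "real^'n \<Rightarrow> ereal"
  assumes f: "convex_extended f" and x: "f x < \<infinity>"
  shows "midpoint_defect f \<eta> x t < ereal D \<longleftrightarrow>
    (\<exists>v. \<eta> \<bullet> v = t \<and> f (x + v) < \<infinity> \<and> f (x - v) < \<infinity> \<and>
      (real_of_ereal (f (x + v)) + real_of_ereal (f (x - v)) - 2 * real_of_ereal (f x)) / 2 < D)"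
proof -
  obtain a where a: "f x = ereal a" using x by (rule convex_extended_finite[OF f])
  \<comment> \<open>As \<open>f x\<close> is finite and \<open>-\<infinity>\<close> is excluded, an
    infinite \<open>f y\<close> or \<open>f z\<close> makes the quotient
    \<open>\<infinity>\<close>.\<close>
  have less: "(f y + f z - 2 * f x) / 2 < ereal D \<longleftrightarrow> f y < \<infinity> \<and> f z < \<infinity> \<and>
      (real_of_ereal (f y) + real_of_ereal (f z) - 2 * real_of_ereal (f x)) / 2 < D" for y z
    using f unfolding convex_extended_def
    by (cases "f y"; cases "f z") (auto simp: a numeral_eq_ereal)
  have "midpoint_defect f \<eta> x t < ereal D \<longleftrightarrow>
      (\<exists>y z. y + z = 2 *\<^sub>R x \<and> \<eta> \<bullet> (y - z) = 2 * t \<and> (f y + f z - 2 * f x) / 2 < ereal D)"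
    by (auto simp: midpoint_defect_def INF_less_iff)
  also have "\<dots> \<longleftrightarrow> (\<exists>v. \<eta> \<bullet> v = t \<and> (f (x + v) + f (x - v) - 2 * f x) / 2 < ereal D)"
  proof safe
    fix y z assume yz: "y + z = 2 *\<^sub>R x" "\<eta> \<bullet> (y - z) = 2 * t" "(f y + f z - 2 * f x) / 2 < ereal D"
    have z: "z = x - (y - x)" using yz(1) by (simp add: algebra_simps scaleR_2)
    have "y - z = 2 *\<^sub>R (y - x)" unfolding z by (simp add: algebra_simps scaleR_2)
    with yz(2) have "\<eta> \<bullet> (y - x) = t" by simp
    with yz(3) z show "\<exists>v. \<eta> \<bullet> v = t \<and> (f (x + v) + f (x - v) - 2 * f x) / 2 < ereal D"
      by (intro exI[of _ "y - x"]) simp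
  next
    fix v assume v: "(f (x + v) + f (x - v) - 2 * f x) / 2 < ereal D"
    have "(x + v) + (x - v) = 2 *\<^sub>R x" by (simp add: scaleR_2)
    moreover have "\<eta> \<bullet> ((x + v) - (x - v)) = 2 * (\<eta> \<bullet> v)"
      unfolding inner_diff_right inner_add_right by simp
    ultimately show "\<exists>y z. y + z = 2 *\<^sub>R x \<and> \<eta> \<bullet> (y - z) = 2 * (\<eta> \<bullet> v) \<and> (f y + f z - 2 * f x) / 2 < ereal D"
      using v by blast
  qed
  finally show ?thesis by (simp only: less)
qed

text \<open>The complement of the defect set in the domain of \<open>f\<close> is open, as a union of strict sublevel sets
  of continuous functions.\<close>

lemma sets_defect_set:
  fixes f :: "real^'n \<Rightarrow> ereal"
  assumes f: "convex_extended f" and op: "open {x. f x < \<infinity>}"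
  shows "defect_set f \<eta> D t \<in> sets borel"
proof -
  let ?F = "\<lambda>x. real_of_ereal (f x)" and ?dom = "{x. f x < \<infinity>}"
  have cont: "continuous_on ?dom ?F"
    using assms by (rule continuous_on_real_of_convex_extended)
  define G where "G v = ?dom \<inter> ((\<lambda>x. x + v) -` ?dom) \<inter> ((\<lambda>x. x - v) -` ?dom)" for v
  have openG: "open (G v)" for v
    unfolding G_def using op by (intro open_Int open_vimage continuous_intros)
  define U where "U v = {x \<in> G v. (?F (x + v) + ?F (x - v) - 2 * ?F x) / 2 < D}" for v
  have "open (U v)" for v
  proof -
    have "continuous_on (G v) (\<lambda>x. (?F (x + v) + ?F (x - v) - 2 * ?F x) / 2)"
      by (intro continuous_intros continuous_on_compose2[OF cont]) (auto simp: G_def)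
    from continuous_open_preimage[OF this openG, of "{..<D}"] show ?thesis
      by (simp add: U_def vimage_def Int_def)
  qed
  then have "?dom - (\<Union>v\<in>{v. \<eta> \<bullet> v = t}. U v) \<in> sets borel"
    using op by (intro sets.Diff borel_open open_UN) auto
  moreover have "defect_set f \<eta> D t = ?dom - (\<Union>v\<in>{v. \<eta> \<bullet> v = t}. U v)"
    by (auto simp: defect_set_def U_def G_def midpoint_defect_less_iff[OF f] simp flip: not_less)
  ultimately show ?thesis by simp
qed

lemma exp_minus_mult_le:
  fixes f :: "real^'n \<Rightarrow> ereal"
  assumes f: "convex_extended f" and t: "\<eta> \<bullet> (y - z) = 2 * t" and x: "x = (1/2) *\<^sub>R (y + z)"
  shows "exp_minus (f y) * exp_minus (f z)
    \<le> (exp_minus (f x) * (1 - indicator (defect_set f \<eta> D t) x * (1 - exp (- D))))\<^sup>2"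
proof (cases "f y = \<infinity> \<or> f z = \<infinity>")
  case True
  then show ?thesis by (auto simp: exp_minus_def)
next
  case False
  obtain a where a: "f y = ereal a" using convex_extended_finite[OF f, of y] False by auto
  obtain b where b: "f z = ereal b" using convex_extended_finite[OF f, of z] False by auto
  obtain c where c: "f x = ereal c" "c \<le> (a + b) / 2"
    using convex_extended_midpoint[OF f a b] unfolding x .
  \<comment> \<open>\<open>exp (- r)\<close> is the damping factor both on and off the defect set,
    so one estimate of \<open>r\<close> covers both cases: by the defect on the set, by convexity
    off it.\<close>
  define r where "r = (if x \<in> defect_set f \<eta> D t then D else 0)"
  have r: "r \<le> (a + b) / 2 - c"
  proof (cases "x \<in> defect_set f \<eta> D t")
    case True
    have "ereal D \<le> midpoint_defect f \<eta> x t" using True by (simp add: defect_set_def)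
    also have "\<dots> \<le> (f y + f z - 2 * f x) / 2"
      unfolding midpoint_defect_def using t x by (intro INF_lower2[of "(y, z)"]) auto
    finally show ?thesis using True by (simp add: r_def a b c numeral_eq_ereal field_simps)
  qed (use c in \<open>simp add: r_def\<close>)
  have "exp_minus (f y) * exp_minus (f z) = exp (- ((a + b) / 2))^2"
    by (simp add: exp_minus_def a b power2_eq_square flip: exp_add)
  also have "\<dots> \<le> (exp (- c) * exp (- r))\<^sup>2"
    using r by (intro power_mono) (auto simp flip: exp_add)
  also have "exp (- c) * exp (- r) = exp_minus (f x) * (1 - indicator (defect_set f \<eta> D t) x * (1 - exp (- D)))"
    by (simp add: exp_minus_def c r_def)
  finally show ?thesis .
qed

section \<open>The marginal inequality\<close>

text \<open>The integral over the hyperplane at level \<open>r\<close>, normalised so that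
  integration over \<open>r\<close> recovers Lebesgue measure. Its values are extended, so infinite
  slices stay visible.\<close>

definition slice_integral :: "('a::euclidean_space \<Rightarrow> real) \<Rightarrow> 'a \<Rightarrow> real \<Rightarrow> ennreal" where
  "slice_integral u \<eta> r = (\<integral>\<^sup>+x. ennreal (u (x + r *\<^sub>R unit_step \<eta>)) \<partial>slab_measure \<eta>)"

lemma borel_measurable_slice_integral:
  assumes [measurable]: "u \<in> borel_measurable borel" and "\<eta> \<noteq> 0"
  shows "slice_integral u \<eta> \<in> borel_measurable borel"
proof -
  interpret sigma_finite_measure "slab_measure \<eta>" using assms(2) by (rule sigma_finite_slab_measure)
  show ?thesis unfolding slice_integral_def[abs_def] by (rule borel_measurable_nn_integral) measurable
qed

lemma slice_integral_add:
  assumes [measurable]: "u \<in> borel_measurable borel" "v \<in> borel_measurable borel"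
    and "\<And>x. 0 \<le> u x" "\<And>x. 0 \<le> v x"
  shows "slice_integral (\<lambda>x. u x + v x) \<eta> r = slice_integral u \<eta> r + slice_integral v \<eta> r"
  unfolding slice_integral_def using assms(3,4) by (subst nn_integral_add[symmetric]) auto

lemma slice_integral_cmult:
  assumes [measurable]: "u \<in> borel_measurable borel" and "0 \<le> a"
  shows "slice_integral (\<lambda>x. a * u x) \<eta> r = ennreal a * slice_integral u \<eta> r"
  unfolding slice_integral_def using assms(2) by (subst nn_integral_cmult[symmetric]) (auto simp: ennreal_mult')

text \<open>\<open>enn2real\<close> sends \<open>\<infinity>\<close> to 0, the value of the Bochner
  integral of a nonintegrable function, so the identity also covers infinite slices.\<close>

lemma set_integral_hausdorff_hyperplane:
  fixes \<eta> :: "real^'n"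
  assumes "\<eta> \<noteq> 0"
  shows "\<exists>c\<ge>0. \<forall>u r. u \<in> borel_measurable borel \<longrightarrow> (\<forall>x. 0 \<le> u x) \<longrightarrow>
      (LINT x:{x. \<eta> \<bullet> x = r}|hausdorff_measure (CARD('n) - 1). u x) = c * enn2real (slice_integral u \<eta> r)"
proof -
  let ?H = "hausdorff_measure (CARD('n) - 1) :: (real^'n) measure"
  obtain c where c: "0 \<le> c"
    "\<forall>u\<in>borel_measurable borel. \<forall>r. (\<integral>\<^sup>+x. indicator {x. \<eta> \<bullet> x = r} x * u x \<partial>?H)
        = ennreal c * (\<integral>\<^sup>+x. u (x + r *\<^sub>R unit_step \<eta>) \<partial>slab_measure \<eta>)"
    using nn_integral_hausdorff_hyperplane[OF assms] by blast
  show ?thesis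
  proof (intro exI[of _ c] conjI allI impI)
    show "0 \<le> c" by (rule c(1))
    fix u :: "real^'n \<Rightarrow> real" and r
    assume [measurable]: "u \<in> borel_measurable borel" and "\<forall>x. 0 \<le> u x"
    then have nn: "\<And>x. 0 \<le> u x" by simp
    have "(LINT x:{x. \<eta> \<bullet> x = r}|?H. u x) = enn2real (\<integral>\<^sup>+x. ennreal (indicator {x. \<eta> \<bullet> x = r} x *\<^sub>R u x) \<partial>?H)"
      unfolding set_lebesgue_integral_def by (rule integral_eq_nn_integral) (auto simp: nn)
    also have "(\<integral>\<^sup>+x. ennreal (indicator {x. \<eta> \<bullet> x = r} x *\<^sub>R u x) \<partial>?H)
        = (\<integral>\<^sup>+x. indicator {x. \<eta> \<bullet> x = r} x * ennreal (u x) \<partial>?H)"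
      by (intro nn_integral_cong) (simp split: split_indicator)
    also have "\<dots> = ennreal c * slice_integral u \<eta> r"
      unfolding slice_integral_def by (rule c(2)[rule_format]) measurable
    finally show "(LINT x:{x. \<eta> \<bullet> x = r}|?H. u x) = c * enn2real (slice_integral u \<eta> r)"
      using c(1) by (simp add: enn2real_mult)
  qed
qed

text \<open>With the defect condition in the integrand, numerator and denominator of the conditional
  probability are integrals over the same hyperplane and share its constant.\<close>

lemma set_integral_defect_set:
  "(LINT x:{x. \<eta> \<bullet> x = s \<and> f x < \<infinity> \<and> midpoint_defect f \<eta> x t \<ge> ereal D}|N. (g x :: real))
    = (LINT x:{x. \<eta> \<bullet> x = s}|N. indicator (defect_set f \<eta> D t) x * g x)"
  unfolding set_lebesgue_integral_def
  by (intro Bochner_Integration.integral_cong) (auto simp: defect_set_def indicator_def)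

lemma slice_integral_prekopa_leindler:
  fixes f :: "real^'n \<Rightarrow> ereal"
  assumes f: "convex_extended f" "open {x. f x < \<infinity>}" and \<eta>: "\<eta> \<noteq> 0"
  shows "slice_integral (\<lambda>x. exp_minus (f x)) \<eta> (s + t) * slice_integral (\<lambda>x. exp_minus (f x)) \<eta> (s - t)
    \<le> (slice_integral (\<lambda>x. exp_minus (f x) * (1 - indicator (defect_set f \<eta> D t) x * (1 - exp (- D)))) \<eta> s)\<^sup>2"
  unfolding slice_integral_def
proof (rule prekopa_leindler_slab_measure)
  note [measurable] = borel_measurable_exp_minus[OF f] sets_defect_set[OF f]
  show "(\<lambda>x. ennreal (exp_minus (f (x + (s + t) *\<^sub>R unit_step \<eta>)))) \<in> borel_measurable borel"
    "(\<lambda>x. ennreal (exp_minus (f (x + (s - t) *\<^sub>R unit_step \<eta>)))) \<in> borel_measurable borel"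
    "(\<lambda>x. ennreal (exp_minus (f (x + s *\<^sub>R unit_step \<eta>)) *
      (1 - indicator (defect_set f \<eta> D t) (x + s *\<^sub>R unit_step \<eta>) * (1 - exp (- D))))) \<in> borel_measurable borel"
    by measurable
  let ?w = "\<lambda>x. 1 - indicator (defect_set f \<eta> D t) x * (1 - exp (- D))"
  have w: "0 \<le> ?w x" for x by (simp add: indicator_def)
  fix x y assume xy: "\<eta> \<bullet> x = 0" "\<eta> \<bullet> y = 0"
  \<comment> \<open>The point at level \<open>s + t\<close> comes first, matching the sign of
    \<open>2 * t\<close> in \<open>midpoint_defect\<close>; the midpoint has level
    \<open>s\<close>.\<close>
  let ?y = "x + (s + t) *\<^sub>R unit_step \<eta>" and ?z = "y + (s - t) *\<^sub>R unit_step \<eta>"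
  let ?m = "(1/2) *\<^sub>R (x + y) + s *\<^sub>R unit_step \<eta>"
  have m: "?m = (1/2) *\<^sub>R (?y + ?z)"
    by (simp add: algebra_simps flip: scaleR_add_left)
  have "\<eta> \<bullet> (?y - ?z) = 2 * t"
    using xy \<eta> by (simp add: inner_diff_right inner_add_right)
  from exp_minus_mult_le[OF f(1) this m, of D]
  have "ennreal (exp_minus (f ?y) * exp_minus (f ?z)) \<le> ennreal ((exp_minus (f ?m) * ?w ?m)\<^sup>2)"
    by (rule ennreal_leI)
  then show "ennreal (exp_minus (f ?y)) * ennreal (exp_minus (f ?z)) \<le> (ennreal (exp_minus (f ?m) * ?w ?m))\<^sup>2"
    using w[of ?m] by (simp only: ennreal_mult[OF exp_minus_nonneg exp_minus_nonneg]
        ennreal_power[OF mult_nonneg_nonneg[OF exp_minus_nonneg]])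
qed (rule \<eta>)

lemma slice_integral_mono:
  "(\<And>x. u x \<le> v x) \<Longrightarrow> slice_integral u \<eta> r \<le> slice_integral v \<eta> r"
  unfolding slice_integral_def by (intro nn_integral_mono ennreal_leI)

text \<open>If \<open>u\<close> is the density of a random vector, this identifies
  \<open>slice_integral u \<eta>\<close> as a density of its inner product with
  \<open>\<eta>\<close>.\<close>

lemma nn_integral_lborel_slice_integral:
  assumes [measurable]: "u \<in> borel_measurable borel" "C \<in> sets borel" and \<eta>: "\<eta> \<noteq> 0"
  shows "(\<integral>\<^sup>+x. ennreal (u x) * indicator C (\<eta> \<bullet> x) \<partial>lborel)
    = (\<integral>\<^sup>+r. slice_integral u \<eta> r * indicator C r \<partial>lborel)"
proof -
  have "(\<integral>\<^sup>+x. ennreal (u (x + r *\<^sub>R unit_step \<eta>)) * indicator C (\<eta> \<bullet> (x + r *\<^sub>R unit_step \<eta>)) \<partial>slab_measure \<eta>)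
      = slice_integral u \<eta> r * indicator C r" for r
  proof -
    have "(\<integral>\<^sup>+x. ennreal (u (x + r *\<^sub>R unit_step \<eta>)) * indicator C (\<eta> \<bullet> (x + r *\<^sub>R unit_step \<eta>)) \<partial>slab_measure \<eta>)
        = (\<integral>\<^sup>+x. ennreal (u (x + r *\<^sub>R unit_step \<eta>)) * indicator C r \<partial>slab_measure \<eta>)"
      using AE_slab_measure[OF \<eta>] \<eta> by (intro nn_integral_cong_AE) (auto simp: inner_add_right)
    then show ?thesis by (simp add: slice_integral_def nn_integral_multc)
  qed
  then show ?thesis
    by (subst nn_integral_lborel_slices[OF _ \<eta>]) auto
qed

text \<open>The normalising constant of the Hausdorff measure cancels: both sides of the inequality are
  proportional to it, and the conditional probability does not depend on it.\<close>

lemma marginal_defect_inequality: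
  fixes f :: "real^'n \<Rightarrow> ereal"
  assumes f: "convex_extended f" "open {x. f x < \<infinity>}" and \<eta>: "\<eta> \<noteq> 0"
    and D: "0 \<le> D" and pos: "marginal_density f \<eta> s > 0"
  shows "sqrt (marginal_density f \<eta> (s - t) * marginal_density f \<eta> (s + t))
      \<le> (1 - defect_cond_prob f \<eta> D s t * (1 - exp (- D))) * marginal_density f \<eta> s"
proof -
  note [measurable] = borel_measurable_exp_minus[OF f] sets_defect_set[OF f]
  let ?g = "\<lambda>x. exp_minus (f x)" and ?B = "defect_set f \<eta> D t"
  let ?gB = "\<lambda>x. indicator ?B x * ?g x"
  let ?h = "\<lambda>x. ?g x * (1 - indicator ?B x * (1 - exp (- D)))"
  obtain c where c: "0 \<le> c"
    "\<forall>u r. u \<in> borel_measurable borel \<longrightarrow> (\<forall>x. 0 \<le> u x) \<longrightarrow>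
      (LINT x:{x. \<eta> \<bullet> x = r}|hausdorff_measure (CARD('n) - 1). u x) = c * enn2real (slice_integral u \<eta> r)"
    using set_integral_hausdorff_hyperplane[OF \<eta>] by blast
  define a where "a r = enn2real (slice_integral ?g \<eta> r)" for r
  define b where "b = enn2real (slice_integral ?gB \<eta> s)"
  define k where "k = c / norm \<eta>"
  have k: "0 \<le> k" using c(1) by (simp add: k_def)
  have marg: "marginal_density f \<eta> r = k * a r" for r
    unfolding marginal_density_def a_def k_def by (subst c(2)[rule_format]) auto
  have ka: "0 < k" "0 < a s" using pos k by (auto simp: marg zero_less_mult_iff)
  then have c0: "c \<noteq> 0" by (auto simp: k_def)
  have gamma: "defect_cond_prob f \<eta> D s t = b / a s"
    unfolding defect_cond_prob_def set_integral_defect_set a_def b_def using c0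
    by (subst (1 2) c(2)[rule_format]) auto
  \<comment> \<open>An infinite slice would give the value 0 under \<open>enn2real\<close>, so
    positivity yields finiteness.\<close>
  have fin: "slice_integral ?g \<eta> s < top"
    using ka(2) by (auto simp: a_def enn2real_positive_iff)
  have h0: "0 \<le> ?h x" for x by (simp add: indicator_def)
  have "slice_integral ?gB \<eta> s \<le> slice_integral ?g \<eta> s"
    by (rule slice_integral_mono) (simp add: indicator_def)
  then have finB: "slice_integral ?gB \<eta> s < top" using fin by (rule order_le_less_trans)
  have "slice_integral ?h \<eta> s \<le> slice_integral ?g \<eta> s"
    using D by (intro slice_integral_mono) (simp add: indicator_def mult_left_le)
  then have finh: "slice_integral ?h \<eta> s < top" using fin by (rule order_le_less_trans)
  \<comment> \<open>The damped integral is obtained by splitting \<open>?g\<close> into a sum, which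
    avoids subtraction in \<open>ennreal\<close>.\<close>
  have "slice_integral ?g \<eta> s = slice_integral (\<lambda>x. ?h x + (1 - exp (- D)) * ?gB x) \<eta> s"
    by (simp add: algebra_simps)
  also have "\<dots> = slice_integral ?h \<eta> s + slice_integral (\<lambda>x. (1 - exp (- D)) * ?gB x) \<eta> s"
    using D h0 by (intro slice_integral_add) auto
  also have "slice_integral (\<lambda>x. (1 - exp (- D)) * ?gB x) \<eta> s = ennreal (1 - exp (- D)) * slice_integral ?gB \<eta> s"
    using D by (intro slice_integral_cmult) auto
  finally have "a s = enn2real (slice_integral ?h \<eta> s) + (1 - exp (- D)) * b"
    using finh finB D by (simp add: a_def b_def enn2real_plus enn2real_mult ennreal_mult_less_top)
  then have w: "enn2real (slice_integral ?h \<eta> s) = a s - (1 - exp (- D)) * b" by simp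
  \<comment> \<open>Passing to reals requires finiteness only on the right, that is, at level
    \<open>s\<close>.\<close>
  have "enn2real (slice_integral ?g \<eta> (s + t) * slice_integral ?g \<eta> (s - t))
      \<le> enn2real ((slice_integral ?h \<eta> s)\<^sup>2)"
    using finh by (intro enn2real_mono slice_integral_prekopa_leindler f \<eta>)
      (simp add: power2_eq_square ennreal_mult_less_top)
  then have "a (s + t) * a (s - t) \<le> (a s - (1 - exp (- D)) * b)\<^sup>2"
    by (simp add: a_def enn2real_mult power2_eq_square flip: w[unfolded a_def])
  then have "sqrt (a (s - t) * a (s + t)) \<le> a s - (1 - exp (- D)) * b"
    using enn2real_nonneg[of "slice_integral ?h \<eta> s"] unfolding w by (simp add: real_le_lsqrt mult.commute)
  then have "k * sqrt (a (s - t) * a (s + t)) \<le> k * (a s - (1 - exp (- D)) * b)"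
    using k by (rule mult_left_mono)
  moreover have "sqrt ((k * a (s - t)) * (k * a (s + t))) = k * sqrt (a (s - t) * a (s + t))"
    using k by (simp add: real_sqrt_mult mult.assoc mult.left_commute)
  moreover have "(1 - b / a s * (1 - exp (- D))) * (k * a s) = k * (a s - (1 - exp (- D)) * b)"
    using ka(2) by (simp add: field_simps)
  ultimately show ?thesis unfolding marg gamma by (simp only:)
qed

section \<open>From the pointwise inequality to the probability bound\<close>

lemma (in prob_space) marginal_defect_probability:
  fixes f :: "real^'n \<Rightarrow> ereal"
  assumes f: "convex_extended f" "open {x. f x < \<infinity>}" and \<eta>: "\<eta> \<noteq> 0"
    and X: "distributed M lborel X (\<lambda>x. ennreal (exp_minus (f x)))"
    and D: "0 \<le> D"
    and prob: "\<P>(\<omega> in M. f (X \<omega>) < \<infinity> \<and> midpoint_defect f \<eta> (X \<omega>) t \<ge> ereal D) \<ge> 3 / 4"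
  shows "\<P>(\<omega> in M. sqrt (marginal_density f \<eta> (\<eta> \<bullet> X \<omega> + t) * marginal_density f \<eta> (\<eta> \<bullet> X \<omega> - t))
      \<le> (1 - 1 / 2 * (1 - exp (- D))) * marginal_density f \<eta> (\<eta> \<bullet> X \<omega>)) \<ge> 1 / 2"
proof -
  note [measurable] = borel_measurable_exp_minus[OF f] sets_defect_set[OF f]
  let ?g = "\<lambda>x. exp_minus (f x)" and ?B = "defect_set f \<eta> D t"
  let ?gB = "\<lambda>x. indicator ?B x * ?g x" and ?gC = "\<lambda>x. indicator (- ?B) x * ?g x"
  have [measurable]: "X \<in> borel_measurable M"
    using distributed_measurable[OF X] by simp
  obtain c where c: "0 \<le> c"
    "\<forall>u r. u \<in> borel_measurable borel \<longrightarrow> (\<forall>x. 0 \<le> u x) \<longrightarrow>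
      (LINT x:{x. \<eta> \<bullet> x = r}|hausdorff_measure (CARD('n) - 1). u x) = c * enn2real (slice_integral u \<eta> r)"
    using set_integral_hausdorff_hyperplane[OF \<eta>] by blast
  have marg: "marginal_density f \<eta> r = c / norm \<eta> * enn2real (slice_integral ?g \<eta> r)" for r
    unfolding marginal_density_def by (subst c(2)[rule_format]) auto
  have [measurable]: "slice_integral u \<eta> \<in> borel_measurable borel" if "u \<in> borel_measurable borel" for u
    using that \<eta> by (rule borel_measurable_slice_integral)
  have [measurable]: "marginal_density f \<eta> \<in> borel_measurable borel"
    unfolding marg[abs_def] by measurable
  \<comment> \<open>The event depends on \<open>X\<close> only through
    \<open>\<eta> \<bullet> X\<close>, so it is the preimage of a Borel set of levels.\<close>
  define R where "R = {r. sqrt (marginal_density f \<eta> (r + t) * marginal_density f \<eta> (r - t))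
      \<le> (1 - 1 / 2 * (1 - exp (- D))) * marginal_density f \<eta> r}"
  have [measurable]: "R \<in> sets borel" unfolding R_def by measurable
  have goal_eq: "\<P>(\<omega> in M. sqrt (marginal_density f \<eta> (\<eta> \<bullet> X \<omega> + t) * marginal_density f \<eta> (\<eta> \<bullet> X \<omega> - t))
      \<le> (1 - 1 / 2 * (1 - exp (- D))) * marginal_density f \<eta> (\<eta> \<bullet> X \<omega>)) = \<P>(\<omega> in M. \<eta> \<bullet> X \<omega> \<in> R)"
    by (simp add: R_def)
  have prob_eq: "\<P>(\<omega> in M. f (X \<omega>) < \<infinity> \<and> midpoint_defect f \<eta> (X \<omega>) t \<ge> ereal D) = \<P>(\<omega> in M. X \<omega> \<in> ?B)"
    by (simp add: defect_set_def)
  have emX: "emeasure M {\<omega> \<in> space M. X \<omega> \<in> A} = (\<integral>\<^sup>+x. ennreal (?g x) * indicator A x \<partial>lborel)"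
    if "A \<in> sets borel" for A
    using distributed_emeasure[OF X, of A] that by (simp add: vimage_def Int_def conj_commute)
  show ?thesis
  proof (cases "c = 0")
    case True
    \<comment> \<open>All marginal densities vanish here, and the inequality reads 0 \<le>
      0.\<close>
    then have "R = UNIV" by (simp add: R_def marg)
    then show ?thesis unfolding goal_eq by (simp add: prob_space)
  next
    case False
    with c(1) \<eta> have c0: "0 < c / norm \<eta>" by simp
    have total: "(\<integral>\<^sup>+r. slice_integral ?g \<eta> r \<partial>lborel) = 1"
    proof -
      have "(\<integral>\<^sup>+r. slice_integral ?g \<eta> r \<partial>lborel) = (\<integral>\<^sup>+x. ennreal (?g x) \<partial>lborel)"
        using nn_integral_lborel_slice_integral[of ?g UNIV \<eta>] \<eta> by simp
      also have "\<dots> = emeasure M {\<omega> \<in> space M. X \<omega> \<in> UNIV}" by (subst emX) auto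
      finally show ?thesis by (simp add: emeasure_space_1)
    qed
    \<comment> \<open>At an infinite slice the marginal density is 0 by default and says nothing
      about the slice; such levels are null because the total mass is 1.\<close>
    have AE_fin: "AE r in lborel. slice_integral ?g \<eta> r \<noteq> \<infinity>"
      by (rule nn_integral_noteq_infinite) (simp_all add: total)
    \<comment> \<open>At a level outside \<open>R\<close> the defect set carries less than half of
      the slice, so the slice is at most twice its part off the defect set.\<close>
    have bad: "slice_integral ?g \<eta> r * indicator (- R) r \<le> 2 * slice_integral ?gC \<eta> r"
      if fin: "slice_integral ?g \<eta> r \<noteq> \<infinity>" for r
    proof (cases "r \<in> R \<or> slice_integral ?g \<eta> r = 0")
      case False
      define a where "a = enn2real (slice_integral ?g \<eta> r)"
      define b where "b = enn2real (slice_integral ?gB \<eta> r)"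
      have a: "0 < a" "slice_integral ?g \<eta> r = ennreal a"
        using False fin by (auto simp: a_def enn2real_positive_iff less_top zero_less_iff_neq_zero)
      have split: "slice_integral ?g \<eta> r = slice_integral ?gB \<eta> r + slice_integral ?gC \<eta> r"
      proof -
        have "slice_integral ?g \<eta> r = slice_integral (\<lambda>x. ?gB x + ?gC x) \<eta> r"
          by (intro arg_cong2[where f="\<lambda>u. slice_integral u \<eta>"]) (auto simp: indicator_def fun_eq_iff)
        then show ?thesis by (subst (asm) slice_integral_add) auto
      qed
      obtain b' d where bd: "slice_integral ?gB \<eta> r = ennreal b'" "0 \<le> b'" "slice_integral ?gC \<eta> r = ennreal d" "0 \<le> d"
        using split fin by (cases "slice_integral ?gB \<eta> r"; cases "slice_integral ?gC \<eta> r") auto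
      have ab: "a = b + d"
        using split bd a by (auto simp: b_def simp flip: ennreal_plus)
      have pos: "marginal_density f \<eta> r > 0" using mult_pos_pos[OF c0 a(1)] by (simp only: marg a_def)
      have gamma: "defect_cond_prob f \<eta> D r t = b / a"
        unfolding defect_cond_prob_def set_integral_defect_set a_def b_def using \<open>c \<noteq> 0\<close>
        by (subst (1 2) c(2)[rule_format]) auto
      \<comment> \<open>A conditional probability of at least 1/2 would, by the pointwise inequality
        at \<open>r\<close>, put \<open>r\<close> into \<open>R\<close>.\<close>
      have "b / a < 1 / 2"
      proof (rule ccontr)
        assume "\<not> b / a < 1 / 2"
        then have "1 / 2 * (1 - exp (- D)) \<le> b / a * (1 - exp (- D))"
          using D by (intro mult_right_mono) auto
        then have "(1 - b / a * (1 - exp (- D))) * marginal_density f \<eta> r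
            \<le> (1 - 1 / 2 * (1 - exp (- D))) * marginal_density f \<eta> r"
          using pos by (intro mult_right_mono) auto
        with marginal_defect_inequality[OF f \<eta> D pos, of t] have "r \<in> R"
          unfolding R_def gamma by (simp add: mult.commute)
        with False show False by simp
      qed
      then have "a \<le> 2 * d" using a(1) ab by (simp add: field_simps)
      then have "ennreal a \<le> ennreal (2 * d)" by (rule ennreal_leI)
      then show ?thesis using False bd a by (simp add: ennreal_mult)
    qed auto
    have "emeasure M {\<omega> \<in> space M. \<eta> \<bullet> X \<omega> \<in> - R} = (\<integral>\<^sup>+r. slice_integral ?g \<eta> r * indicator (- R) r \<partial>lborel)"
      using emX[of "{x. \<eta> \<bullet> x \<in> - R}"] nn_integral_lborel_slice_integral[of ?g "- R" \<eta>] \<eta>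
      by (simp add: indicator_def)
    also have "\<dots> \<le> (\<integral>\<^sup>+r. 2 * slice_integral ?gC \<eta> r \<partial>lborel)"
      by (rule nn_integral_mono_AE, use AE_fin in eventually_elim) (rule bad)
    also have "\<dots> = 2 * (\<integral>\<^sup>+x. ennreal (?gC x) \<partial>lborel)"
      using nn_integral_lborel_slice_integral[of ?gC UNIV \<eta>] \<eta> by (simp add: nn_integral_cmult)
    also have "(\<integral>\<^sup>+x. ennreal (?gC x) \<partial>lborel) = (\<integral>\<^sup>+x. ennreal (?g x) * indicator (- ?B) x \<partial>lborel)"
      by (intro nn_integral_cong) (simp add: indicator_def)
    also have "\<dots> = emeasure M {\<omega> \<in> space M. X \<omega> \<in> - ?B}" by (subst emX) auto
    finally have "ennreal (\<P>(\<omega> in M. \<eta> \<bullet> X \<omega> \<in> - R)) \<le> ennreal (2 * \<P>(\<omega> in M. X \<omega> \<in> - ?B))"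
      by (simp add: emeasure_eq_measure ennreal_mult')
    then have "\<P>(\<omega> in M. \<not> \<eta> \<bullet> X \<omega> \<in> R) \<le> 2 * \<P>(\<omega> in M. \<not> X \<omega> \<in> ?B)"
      by (simp add: ennreal_le_iff)
    moreover have "\<P>(\<omega> in M. \<not> \<eta> \<bullet> X \<omega> \<in> R) = 1 - \<P>(\<omega> in M. \<eta> \<bullet> X \<omega> \<in> R)"
      by (rule prob_neg) measurable
    moreover have "\<P>(\<omega> in M. \<not> X \<omega> \<in> ?B) = 1 - \<P>(\<omega> in M. X \<omega> \<in> ?B)"
      by (rule prob_neg) measurable
    \<comment> \<open>The defect set is missed with probability at most 1/4, and doubling gives
      1/2.\<close>
    ultimately show ?thesis using prob unfolding goal_eq prob_eq by simp
  qed
qed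

theorem theorem1p2:
  fixes f :: "real^'n \<Rightarrow> ereal" and \<eta> :: "real^'n"
    and M :: "'w measure" and X :: "'w \<Rightarrow> real^'n"
  assumes "log_concave_potential f"
    and "prob_space M"
    and "distributed M lborel X (\<lambda>x. ennreal (exp_minus (f x)))"
    and "\<eta> \<noteq> 0"
  shows "(\<forall>D t s. D \<ge> 0 \<longrightarrow> t > 0 \<longrightarrow> marginal_density f \<eta> s > 0 \<longrightarrow>
            sqrt (marginal_density f \<eta> (s - t) * marginal_density f \<eta> (s + t))
              \<le> (1 - defect_cond_prob f \<eta> D s t * (1 - exp (- D))) * marginal_density f \<eta> s)
       \<and> (\<forall>D t. D \<ge> 0 \<longrightarrow> t > 0 \<longrightarrow>
            \<P>(\<omega> in M. f (X \<omega>) < \<infinity> \<and> midpoint_defect f \<eta> (X \<omega>) t \<ge> ereal D) \<ge> 3 / 4 \<longrightarrow>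
            \<P>(\<omega> in M. sqrt (marginal_density f \<eta> (\<eta> \<bullet> X \<omega> + t) * marginal_density f \<eta> (\<eta> \<bullet> X \<omega> - t))
                \<le> (1 - 1 / 2 * (1 - exp (- D))) * marginal_density f \<eta> (\<eta> \<bullet> X \<omega>)) \<ge> 1 / 2)"
proof -
  have f: "convex_extended f" "open {x. f x < \<infinity>}"
    using assms(1) by (auto simp: log_concave_potential_def)
  show ?thesis
    using marginal_defect_inequality[OF f assms(4)]
      prob_space.marginal_defect_probability[OF assms(2) f assms(4,3)] by blast
qed

end
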